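(* Let $(X,\mu)$ and $(Y_j,\nu_j)$, $1\le j\le d$, be measure spaces. Suppose that the linear operators $T_j:\mathcal{S}(Y_j)\to\mathcal{M}(X)$ are positive and that each $T_j$ saturates $X$. Suppose that $1\le p_j\le\infty$ for all $j$, $1\le q\le\infty$, $\alpha_j>0$ and $\sum_{j=1}^d\alpha_j=1$. When $q=1$ suppose additionally that $X$ is $\sigma$-finite. Finally, suppose that for some $A\ge0$ $$\Big\|\prod_{j=1}^d (T_jf_j)^{\alpha_j}\Big\|_{L^q(X)}\le A\prod_{j=1}^d\|f_j\|_{L^{p_j}(Y_j)}^{\alpha_j}$$ for all nonnegative simple functions $f_j\in\mathcal{S}(Y_j)$, $1\le j\le d$. Then for every nonnegative $G\in L^{q'}(X)$ there exist nonnegative measurable functions $g_1,\dots,g_d$ on $X$ such that $$G(x)\le\prod_{j=1}^d g_j(x)^{\alpha_j}\quad\text{for a.e. }x\in X,$$ and such that for each $j$, $$\int_X g_j(x)\,T_jf_j(x)\,d\mu(x)\le A\,\|G\|_{L^{q'}(X)}\|f_j\|_{L^{p_j}(Y_j)}$$ for all simple functions $f_j\in\mathcal{S}(Y_j)$.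
   Context: $\mathcal{S}(Y)$ denotes the real-valued simple functions on a measure space $Y$ (finite linear combinations of characteristic functions of measurable sets of finite measure), and $\mathcal{M}(X)$ the real-valued measurable functions on $X$. A linear map $T:\mathcal{S}(Y)\to\mathcal{M}(X)$ is positive if $f\ge0$ a.e. on $Y$ implies $Tf\ge0$ a.e. on $X$. $T$ saturates $X$ if for each measurable $E\subseteq X$ of positive measure there exist a measurable $E'\subseteq E$ with $\mu(E')>0$ and a nonnegative $h\in\mathcal{S}(Y)$ such that $Th>0$ a.e. on $E'$. $q'$ is the conjugate exponent, $1/q+1/q'=1$. *)

theory Defs
  imports "HOL-Analysis.Analysis" "HOL-Probability.Essential_Supremum"
begin

text \<open>
  The space $\mathcal{S}(Y)$: on \<open>space Y\<close>, these are exactly the finite linear combinations of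
  indicators of measurable sets of finite measure; values off \<open>space Y\<close> are unconstrained.
\<close>

definition simple_functions :: "'b measure \<Rightarrow> ('b \<Rightarrow> real) set" where
  "simple_functions Y =
     {f. simple_function Y f \<and> emeasure Y {y \<in> space Y. f y \<noteq> 0} < \<infinity>}"

text \<open>
  Operators on $\mathcal{S}(Y)$ with values in $\mathcal{M}(X)$. Elements of $\mathcal{M}(X)$ are
  identified when they agree almost everywhere, so linearity is an identity almost everywhere.
  This covers the operators that are linear pointwise. Together with positivity it also
  makes \<open>T\<close> well-defined on almost-everywhere classes of simple functions.
\<close>

definition linear_operator :: "'b measure \<Rightarrow> 'a measure \<Rightarrow> (('b \<Rightarrow> real) \<Rightarrow> 'a \<Rightarrow> real) \<Rightarrow> bool" where
  "linear_operator Y X T \<longleftrightarrow>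
     (\<forall>f\<in>simple_functions Y. T f \<in> borel_measurable X) \<and>
     (\<forall>f\<in>simple_functions Y. \<forall>g\<in>simple_functions Y.
        AE x in X. T (\<lambda>y. f y + g y) x = T f x + T g x) \<and>
     (\<forall>f\<in>simple_functions Y. \<forall>c. AE x in X. T (\<lambda>y. c * f y) x = c * T f x)"

definition positive_operator :: "'b measure \<Rightarrow> 'a measure \<Rightarrow> (('b \<Rightarrow> real) \<Rightarrow> 'a \<Rightarrow> real) \<Rightarrow> bool" where
  "positive_operator Y X T \<longleftrightarrow>
     (\<forall>f\<in>simple_functions Y. (AE y in Y. 0 \<le> f y) \<longrightarrow> (AE x in X. 0 \<le> T f x))"

definition saturates :: "'b measure \<Rightarrow> 'a measure \<Rightarrow> (('b \<Rightarrow> real) \<Rightarrow> 'a \<Rightarrow> real) \<Rightarrow> bool" where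
  "saturates Y X T \<longleftrightarrow>
     (\<forall>E\<in>sets X. emeasure X E > 0 \<longrightarrow>
        (\<exists>E'\<in>sets X. E' \<subseteq> E \<and> emeasure X E' > 0 \<and>
           (\<exists>h\<in>simple_functions Y. (\<forall>y\<in>space Y. 0 \<le> h y) \<and>
              (AE x in X. x \<in> E' \<longrightarrow> T h x > 0))))"

text \<open>Real powers on $[0,\infty]$, meant for exponents \<open>a > 0\<close>.\<close>

definition ennreal_power :: "ennreal \<Rightarrow> real \<Rightarrow> ennreal" where
  "ennreal_power t a = (if t = \<infinity> then \<infinity> else ennreal (enn2real t powr a))"

text \<open>The $L^p$ norm for $1 \le p \le \infty$; it takes the value \<open>\<infinity>\<close> on measurable functions
  outside $L^p$.\<close>

definition Lp_norm :: "ennreal \<Rightarrow> 'a measure \<Rightarrow> ('a \<Rightarrow> real) \<Rightarrow> ennreal" where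
  "Lp_norm p M f =
     (if p = \<infinity> then esssup M (\<lambda>x. ennreal \<bar>f x\<bar>)
      else ennreal_power (\<integral>\<^sup>+x. ennreal (\<bar>f x\<bar> powr enn2real p) \<partial>M) (1 / enn2real p))"

definition Lp_space :: "ennreal \<Rightarrow> 'a measure \<Rightarrow> ('a \<Rightarrow> real) set" where
  "Lp_space p M = {f \<in> borel_measurable M. Lp_norm p M f < \<infinity>}"

end

theory Submission
  imports Defs
begin

text \<open>
  Write \<open>K\<close> for \<open>A\<close> times the norm of \<open>G\<close>. By Hoelder's inequality the assumed bound gives
  \<open>\<integral> G (\<Prod>j. (T j (f j)) powr \<alpha> j) \<le> K\<close> for all nonnegative simple \<open>f j\<close> in the unit balls. The
  weighted arithmetic-geometric mean inequality identifies \<open>c * (\<Prod>j. t j powr \<alpha> j)\<close>, for positive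
  \<open>t j\<close>, as the minimum of \<open>\<Sum>j. \<alpha> j * g j * t j\<close> over all \<open>g\<close> with \<open>c \<le> (\<Prod>j. g j powr \<alpha> j)\<close>; the
  minimum is attained at \<open>g j = c * (\<Prod>k. t k powr \<alpha> k) / t j\<close>. So \<open>K\<close> bounds the supremum over
  \<open>f\<close> of the infimum over admissible \<open>g\<close> of \<open>\<Sum>j. \<alpha> j * \<integral> g j * T j (f j)\<close>, a pairing that is affine
  in \<open>f\<close> and in \<open>g\<close>. Exchanging supremum and infimum produces one \<open>g\<close> for which this sum is at most
  \<open>K\<close> whatever the \<open>f j\<close> in the unit balls (\<open>exists_uniform_factor\<close>).

  The exchange is made in two steps. For finitely many tuples \<open>f\<close> it is a convexity argument in the
  plane, iterated (\<open>finite_minimax\<close>). To treat all \<open>f\<close> at once, observe that the \<open>g\<close> that are good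
  for one \<open>f\<close> up to a given error form a convex set closed under almost everywhere convergence, and
  that finitely many of these sets always meet. On a finite measure space such a family has a common
  point (\<open>convex_compactness\<close>): almost minimisers of a strictly convex functional over larger and
  larger finite intersections form a Cauchy sequence. The finite measure is \<open>w\<close> times the given one,
  for an integrable weight \<open>w\<close> that is positive where \<open>G\<close> is nonzero; for \<open>q > 1\<close> a power of \<open>G\<close>
  serves, and for \<open>q = 1\<close> the space is \<open>\<sigma>\<close>-finite.

  Limits live in \<open>[0,\<infinity>]\<close>. Saturation makes them finite: a factor whose integrals against all \<open>T j f\<close>
  are finite is finite almost everywhere. Likewise a factor for which all of these integrals vanish is
  zero almost everywhere, which forces \<open>G = 0\<close>. Otherwise let \<open>N j > 0\<close> be the supremum of
  \<open>\<integral> g j * T j f\<close> over the \<open>j\<close>-th unit ball. As \<open>\<Sum>j. \<alpha> j * N j \<le> K\<close>, also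
  \<open>(\<Prod>j. N j powr \<alpha> j) \<le> K\<close>, so multiplying each \<open>g j\<close> by \<open>K / N j\<close> does not decrease the geometric
  mean, and it gives every single factor the constant \<open>K\<close> (\<open>factorisation\<close>).
\<close>

section \<open>A minimax inequality for finitely many functionals\<close>

text \<open>
  If the claim fails, a line separates \<open>(K + e, K + e)\<close> from the convex, upward closed set of pairs of
  upper bounds attained on \<open>C\<close>. Its normal can be taken as \<open>(l, 1 - l)\<close> with \<open>0 \<le> l \<le> 1\<close>, and the
  concavity assumption merges \<open>f1\<close> and \<open>f2\<close> with these weights into one element of \<open>B\<close>, whose
  functional comes close to \<open>K\<close> on \<open>C\<close>; the line forbids this. The convexity and concavity
  conditions are those of Ky Fan: they ask for elements that are as good as a convex combination.
\<close>

lemma two_functional_minimax: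
  fixes \<phi> :: "'f \<Rightarrow> 'g \<Rightarrow> ennreal" and K e :: real
  assumes cvx: "\<And>g g' l. g \<in> C \<Longrightarrow> g' \<in> C \<Longrightarrow> 0 \<le> l \<Longrightarrow> l \<le> 1 \<Longrightarrow>
      \<exists>g''\<in>C. \<forall>f\<in>B. \<phi> f g'' \<le> ennreal l * \<phi> f g + ennreal (1 - l) * \<phi> f g'"
    and ccv: "\<And>f f' l. f \<in> B \<Longrightarrow> f' \<in> B \<Longrightarrow> 0 \<le> l \<Longrightarrow> l \<le> 1 \<Longrightarrow>
      \<exists>f''\<in>B. \<forall>g\<in>C. ennreal l * \<phi> f g + ennreal (1 - l) * \<phi> f' g \<le> \<phi> f'' g"
    and inf: "\<And>f e. f \<in> B \<Longrightarrow> 0 < e \<Longrightarrow> \<exists>g\<in>C. \<phi> f g \<le> ennreal (K + e)"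
    and K: "0 \<le> K" and e: "0 < e" and f: "f1 \<in> B" "f2 \<in> B"
  shows "\<exists>g\<in>C. \<phi> f1 g \<le> ennreal (K + e) \<and> \<phi> f2 g \<le> ennreal (K + e)"
proof (rule ccontr)
  assume neg: "\<not> ?thesis"
  define S :: "(real \<times> real) set" where
    "S = {(x, y). 0 \<le> x \<and> 0 \<le> y \<and> (\<exists>g\<in>C. \<phi> f1 g \<le> ennreal x \<and> \<phi> f2 g \<le> ennreal y)}"
  have SI: "(x, y) \<in> S" if "0 \<le> x" "0 \<le> y" "g \<in> C" "\<phi> f1 g \<le> ennreal x" "\<phi> f2 g \<le> ennreal y"
    for x y g
    using that by (auto simp: S_def)
  have "convex S"
  proof (rule convexI)
    fix s t and u v :: real
    assume s: "s \<in> S" and t: "t \<in> S" and uv: "0 \<le> u" "0 \<le> v" "u + v = 1"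
    obtain x y g where [simp]: "s = (x, y)" and xy: "0 \<le> x" "0 \<le> y" "g \<in> C"
      "\<phi> f1 g \<le> ennreal x" "\<phi> f2 g \<le> ennreal y"
      using s by (auto simp: S_def)
    obtain x' y' g' where [simp]: "t = (x', y')" and xy': "0 \<le> x'" "0 \<le> y'" "g' \<in> C"
      "\<phi> f1 g' \<le> ennreal x'" "\<phi> f2 g' \<le> ennreal y'"
      using t by (auto simp: S_def)
    obtain h where h: "h \<in> C"
      "\<And>f. f \<in> B \<Longrightarrow> \<phi> f h \<le> ennreal u * \<phi> f g + ennreal (1 - u) * \<phi> f g'"
      using cvx[OF xy(3) xy'(3), of u] uv by auto
    have *: "\<phi> f h \<le> ennreal (u * a + v * b)"
      if "f \<in> B" "\<phi> f g \<le> ennreal a" "\<phi> f g' \<le> ennreal b" "0 \<le> a" "0 \<le> b" for f a b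
    proof -
      have "\<phi> f h \<le> ennreal u * ennreal a + ennreal v * ennreal b"
        using that(2,3) uv(3)[symmetric]
        by (intro order_trans[OF h(2)[OF that(1)]] add_mono mult_mono) (auto intro!: ennreal_leI)
      also have "\<dots> = ennreal (u * a + v * b)"
        using that uv by (simp add: ennreal_mult ennreal_plus)
      finally show ?thesis .
    qed
    show "u *\<^sub>R s + v *\<^sub>R t \<in> S"
      using *[OF f(1) xy(4) xy'(4)] *[OF f(2) xy(5) xy'(5)] xy xy' uv
      by (auto intro!: SI[OF _ _ h(1)])
  qed
  have finite_value: "\<exists>x y. (x, y) \<in> S \<and> l * x + (1 - l) * y \<le> K + \<delta>"
    if l: "0 < l" "l < 1" and \<delta>: "0 < \<delta>" for l \<delta>
  proof -
    obtain f'' where f'': "f'' \<in> B"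
      "\<And>g. g \<in> C \<Longrightarrow> ennreal l * \<phi> f1 g + ennreal (1 - l) * \<phi> f2 g \<le> \<phi> f'' g"
      using ccv[OF f, of l] l by auto
    obtain g where g: "g \<in> C" "\<phi> f'' g \<le> ennreal (K + \<delta>)"
      using inf[OF f''(1) \<delta>] by auto
    have le: "ennreal l * \<phi> f1 g + ennreal (1 - l) * \<phi> f2 g \<le> ennreal (K + \<delta>)"
      using f''(2)[OF g(1)] g(2) by (rule order_trans)
    then have "\<phi> f1 g \<noteq> top" "\<phi> f2 g \<noteq> top"
      using l by (auto simp: ennreal_mult_top top_unique)
    then obtain x y where xy: "0 \<le> x" "0 \<le> y" "\<phi> f1 g = ennreal x" "\<phi> f2 g = ennreal y"
      by (metis ennreal_cases)
    have "ennreal (l * x + (1 - l) * y) \<le> ennreal (K + \<delta>)"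
      using le xy l by (simp add: ennreal_mult ennreal_plus)
    then have "l * x + (1 - l) * y \<le> K + \<delta>"
      using K \<delta> by (subst (asm) ennreal_le_iff) auto
    then show ?thesis using SI[of x y g] xy g(1) by auto
  qed
  obtain x0 y0 where xy0: "(x0, y0) \<in> S" using finite_value[of "1/2" 1] by auto
  have up: "(x, y) \<in> S" if "x0 \<le> x" "y0 \<le> y" for x y
    using xy0 that by (auto simp: S_def intro: order_trans[OF _ ennreal_leI])
  have "(K + e, K + e) \<notin> S" using neg by (auto simp: S_def)
  then have "\<exists>w c. w \<noteq> 0 \<and> (\<forall>x\<in>{(K + e, K + e)}. w \<bullet> x \<le> c) \<and> (\<forall>x\<in>S. c \<le> w \<bullet> x)"
    using \<open>convex S\<close> xy0 by (intro separating_hyperplane_sets) auto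
  then obtain w c where w: "w \<noteq> 0" "w \<bullet> (K + e, K + e) \<le> c" "\<And>x y. (x, y) \<in> S \<Longrightarrow> c \<le> w \<bullet> (x, y)"
    by blast
  obtain a b where "w = (a, b)" by (cases w)
  with w have ab: "(a, b) \<noteq> (0, 0)"
    and sep: "\<And>x y. (x, y) \<in> S \<Longrightarrow> c \<le> a * x + b * y" "a * (K + e) + b * (K + e) \<le> c"
    by (auto simp: zero_prod_def[symmetric])
  have nonneg: "0 \<le> a" "0 \<le> b"
  proof -
    have "0 \<le> r" if "\<And>t. 0 \<le> t \<Longrightarrow> k \<le> m + r * t" for r k m :: real
    proof (rule ccontr)
      assume "\<not> 0 \<le> r"
      then have "k \<le> m + r * ((\<bar>k\<bar> + \<bar>m\<bar> + 1) / (- r))"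
        by (intro that divide_nonneg_pos) auto
      moreover have "r * ((\<bar>k\<bar> + \<bar>m\<bar> + 1) / (- r)) = - (\<bar>k\<bar> + \<bar>m\<bar> + 1)"
        using \<open>\<not> 0 \<le> r\<close> by (simp add: field_simps)
      ultimately have "k \<le> m + - (\<bar>k\<bar> + \<bar>m\<bar> + 1)" by (simp only:)
      then show False by linarith
    qed note * = this
    show "0 \<le> a"
      by (rule *[of c "a * x0 + b * y0"])
        (use sep(1)[OF up[of "x0 + _" y0]] in \<open>auto simp: algebra_simps\<close>)
    show "0 \<le> b"
      by (rule *[of c "a * x0 + b * y0"])
        (use sep(1)[OF up[of x0 "y0 + _"]] in \<open>auto simp: algebra_simps\<close>)
  qed
  define l where "l = a / (a + b)"
  have ab0: "0 < a + b" using ab nonneg by (auto simp: less_le)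
  have l: "0 \<le> l" "l \<le> 1" using nonneg ab0 by (auto simp: l_def)
  have l_compl: "1 - l = b / (a + b)" using ab0 by (simp add: l_def field_simps)
  have sep': "K + e \<le> l * x + (1 - l) * y" if "(x, y) \<in> S" for x y
  proof -
    have "(a + b) * (K + e) \<le> a * x + b * y"
      using sep(1)[OF that] sep(2) by (simp add: algebra_simps)
    then have "K + e \<le> (a * x + b * y) / (a + b)" using ab0 by (simp add: field_simps)
    also have "\<dots> = l * x + (1 - l) * y"
      using ab0 by (simp add: l_compl) (simp add: l_def add_divide_distrib)
    finally show ?thesis .
  qed
  (* If l is 0 or 1, one functional may be infinite without being seen, because 0 * top = 0.
     So l is moved towards 1/2 by a fraction eta, which costs at most eta * (K + e) = e / 4. *)
  define \<eta> where "\<eta> = e / 4 / (K + e)"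
  have \<eta>: "0 < \<eta>" "\<eta> < 1" using K e by (auto simp: \<eta>_def field_simps)
  have "0 < (1 - \<eta>) * l + \<eta> / 2"
    using \<eta> l by (intro add_nonneg_pos) auto
  moreover have "(1 - \<eta>) * l + \<eta> / 2 < 1"
  proof -
    have "(1 - \<eta>) * l \<le> 1 - \<eta>" using mult_left_mono[of l 1 "1 - \<eta>"] \<eta> l by simp
    then show ?thesis using \<eta> by linarith
  qed
  ultimately obtain x y where S: "(x, y) \<in> S"
    and le: "((1 - \<eta>) * l + \<eta> / 2) * x + (1 - ((1 - \<eta>) * l + \<eta> / 2)) * y \<le> K + e / 2"
    using finite_value[of "(1 - \<eta>) * l + \<eta> / 2" "e / 2"] e by auto
  have xy: "0 \<le> x" "0 \<le> y" using S by (auto simp: S_def)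
  have "(1 - \<eta>) * (K + e) \<le> (1 - \<eta>) * (l * x + (1 - l) * y)"
    using \<eta> by (intro mult_left_mono sep' S) auto
  also have "\<dots> \<le> (1 - \<eta>) * (l * x + (1 - l) * y) + \<eta> / 2 * (x + y)"
    using \<eta> xy by auto
  also have "\<dots> = ((1 - \<eta>) * l + \<eta> / 2) * x + (1 - ((1 - \<eta>) * l + \<eta> / 2)) * y"
    by (simp add: field_simps)
  also note le
  finally have "e / 2 \<le> \<eta> * (K + e)" by (simp add: algebra_simps)
  moreover have "\<eta> * (K + e) = e / 4"
    using nonzero_eq_divide_eq[THEN iffD1, OF _ \<eta>_def] K e by simp
  ultimately show False using e by simp
qed

text \<open>
  Restricting \<open>C\<close> to a sublevel set of one functional keeps it convex, and by the case of two
  functionals the infimum of every other functional over it is at most the level. So the functionals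
  can be treated one after the other, spending half of the remaining error on each.
\<close>

lemma finite_minimax:
  fixes \<phi> :: "'f \<Rightarrow> 'g \<Rightarrow> ennreal" and K e :: real
  assumes "finite F" "F \<subseteq> B" "C \<noteq> {}"
    and "\<And>g g' l. g \<in> C \<Longrightarrow> g' \<in> C \<Longrightarrow> 0 \<le> l \<Longrightarrow> l \<le> 1 \<Longrightarrow>
      \<exists>g''\<in>C. \<forall>f\<in>B. \<phi> f g'' \<le> ennreal l * \<phi> f g + ennreal (1 - l) * \<phi> f g'"
    and "\<And>f f' l. f \<in> B \<Longrightarrow> f' \<in> B \<Longrightarrow> 0 \<le> l \<Longrightarrow> l \<le> 1 \<Longrightarrow>
      \<exists>f''\<in>B. \<forall>g\<in>C. ennreal l * \<phi> f g + ennreal (1 - l) * \<phi> f' g \<le> \<phi> f'' g"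
    and "\<And>f e. f \<in> B \<Longrightarrow> 0 < e \<Longrightarrow> \<exists>g\<in>C. \<phi> f g \<le> ennreal (K + e)"
    and "0 \<le> K" "0 < e"
  shows "\<exists>g\<in>C. \<forall>f\<in>F. \<phi> f g \<le> ennreal (K + e)"
  using assms
proof (induction F arbitrary: C K e rule: finite_induct)
  case empty
  then show ?case by auto
next
  case (insert a F)
  note cvx = insert.prems(3) and ccv = insert.prems(4) and K = insert.prems(6) and e = insert.prems(7)
  have a: "a \<in> B" using insert.prems by auto
  define C' where "C' = {g \<in> C. \<phi> a g \<le> ennreal (K + e / 2)}"
  have "\<exists>g\<in>C'. \<forall>f\<in>F. \<phi> f g \<le> ennreal (K + e / 2 + e / 2)"
  proof (rule insert.IH)
    show "F \<subseteq> B" using insert.prems by auto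
    show "C' \<noteq> {}" using insert.prems(5)[OF a, of "e / 2"] e by (auto simp: C'_def)
    show "\<exists>g''\<in>C'. \<forall>f\<in>B. \<phi> f g'' \<le> ennreal l * \<phi> f g + ennreal (1 - l) * \<phi> f g'"
      if gg: "g \<in> C'" "g' \<in> C'" and l: "0 \<le> l" "l \<le> 1" for g g' l
    proof -
      obtain h where h: "h \<in> C"
        "\<And>f. f \<in> B \<Longrightarrow> \<phi> f h \<le> ennreal l * \<phi> f g + ennreal (1 - l) * \<phi> f g'"
        using cvx[of g g' l] gg l by (auto simp: C'_def)
      have "\<phi> a h \<le> ennreal l * ennreal (K + e / 2) + ennreal (1 - l) * ennreal (K + e / 2)"
        using gg by (intro order_trans[OF h(2)[OF a]] add_mono mult_left_mono) (auto simp: C'_def)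
      also have "\<dots> = ennreal (l * (K + e / 2) + (1 - l) * (K + e / 2))"
        using l K e by (simp add: ennreal_mult ennreal_plus)
      also have "\<dots> = ennreal (K + e / 2)" by (simp flip: distrib_right)
      finally show ?thesis using h by (auto simp: C'_def)
    qed
    show "\<exists>f''\<in>B. \<forall>g\<in>C'. ennreal l * \<phi> f g + ennreal (1 - l) * \<phi> f' g \<le> \<phi> f'' g"
      if "f \<in> B" "f' \<in> B" "0 \<le> l" "l \<le> 1" for f f' l
      using ccv[OF that] by (auto simp: C'_def)
    show "\<exists>g\<in>C'. \<phi> f g \<le> ennreal (K + e / 2 + e')" if f: "f \<in> B" and e': "0 < e'" for f e'
    proof -
      obtain g where g: "g \<in> C" "\<phi> f g \<le> ennreal (K + e / 2)" "\<phi> a g \<le> ennreal (K + e / 2)"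
        using two_functional_minimax[OF cvx ccv insert.prems(5) K _ f a, of "e / 2"] e by auto
      show ?thesis
        using g e' order_trans[OF g(2) ennreal_leI, of "K + e / 2 + e'"] by (auto simp: C'_def)
    qed
  qed (use K e in auto)
  then obtain g where g: "g \<in> C'" "\<And>f. f \<in> F \<Longrightarrow> \<phi> f g \<le> ennreal (K + e)"
    by (auto simp: add.assoc)
  moreover have "\<phi> a g \<le> ennreal (K + e)"
    using g(1) e by (auto simp: C'_def intro: order_trans[OF _ ennreal_leI])
  ultimately show ?case by (auto simp: C'_def)
qed

section \<open>Convex compactness for almost everywhere convergence\<close>

text \<open>
  The function \<open>1 / (1 + t)\<close>: continuous and injective on \<open>[0,\<infinity>]\<close>, bounded, and strictly convex.
\<close>

definition shrink :: "ennreal \<Rightarrow> real" where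
  "shrink t = enn2real (inverse (1 + t))"

lemma ennreal_shrink: "ennreal (shrink t) = inverse (1 + t)"
  by (cases t) (auto simp: shrink_def ennreal_plus[symmetric] inverse_ennreal
      simp del: ennreal_plus simp flip: ennreal_1)

lemma shrink_nonneg: "0 \<le> shrink t" and shrink_le_1: "shrink t \<le> 1"
proof -
  show "0 \<le> shrink t" by (simp add: shrink_def)
  show "shrink t \<le> 1"
    by (cases t) (auto simp: shrink_def ennreal_plus[symmetric] inverse_ennreal field_simps
        simp del: ennreal_plus simp flip: ennreal_1)
qed

lemma shrink_inverse: "inverse (ennreal (shrink t)) - 1 = t"
proof -
  have "inverse (inverse (1 + t)) = 1 + t" by (cases t) (auto simp: ennreal_plus[symmetric] inverse_ennreal
      simp del: ennreal_plus simp flip: ennreal_1)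
  then show ?thesis unfolding ennreal_shrink by simp
qed

lemma borel_measurable_shrink [measurable]: "shrink \<in> borel_measurable borel"
  unfolding shrink_def by measurable

lemma shrink_real: "0 \<le> a \<Longrightarrow> shrink (ennreal a) = 1 / (1 + a)"
  by (auto simp: shrink_def ennreal_plus[symmetric] inverse_ennreal divide_inverse
        simp del: ennreal_plus simp flip: ennreal_1)

lemma shrink_top: "shrink top = 0"
  by (simp add: shrink_def)

text \<open>
  Strict convexity with an explicit gap. With \<open>A = 1 + a\<close> and \<open>B = 1 + b\<close> both sides are multiples of
  \<open>(A - B)\<^sup>2\<close>, and the comparison of the coefficients is \<open>A + B \<le> 2 * A * B\<close>. If one argument is
  infinite, what remains is \<open>r\<^sup>2 \<le> 2 * r\<close> on \<open>[0,1]\<close>.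
\<close>

lemma shrink_midpoint:
  "(shrink a - shrink b)\<^sup>2 / 4
     \<le> (shrink a + shrink b) / 2 - shrink (ennreal (1/2) * a + ennreal (1/2) * b)"
proof -
  have sq: "r\<^sup>2 / 4 \<le> r / 2" if "0 \<le> r" "r \<le> 1" for r :: real
    using mult_left_le[of r r] that by (simp add: power2_eq_square)
  show ?thesis
  proof (cases a)
    case (real x)
    note x = this
    show ?thesis
    proof (cases b)
      case (real y)
      define A B where "A = 1 + x" and "B = 1 + y"
      have AB: "1 \<le> A" "1 \<le> B" using x real by (auto simp: A_def B_def)
      have mid: "ennreal (1/2) * a + ennreal (1/2) * b = ennreal ((x + y) / 2)"
        using x real by (simp add: ennreal_mult[symmetric] ennreal_plus[symmetric] add_divide_distrib
            del: ennreal_plus ennreal_half)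
      have "A + B \<le> 2 * (A * B)"
        using mult_left_mono[OF AB(2), of A] mult_right_mono[OF AB(1), of B] AB by linarith
      then have "(A - B)\<^sup>2 / (4 * (A * B) * (A * B)) \<le> (A - B)\<^sup>2 / (2 * (A * B) * (A + B))"
        using AB by (intro divide_left_mono) (auto simp: mult_ac intro!: mult_left_mono)
      also have "(A - B)\<^sup>2 / (4 * (A * B) * (A * B)) = (1 / A - 1 / B)\<^sup>2 / 4"
        using AB by (simp add: field_simps power2_eq_square)
      also have "(A - B)\<^sup>2 / (2 * (A * B) * (A + B)) = (1 / A + 1 / B) / 2 - 2 / (A + B)"
        using AB by (simp add: field_simps power2_eq_square add_eq_0_iff)
      also have "2 / (A + B) = 1 / (1 + (x + y) / 2)"
        using AB by (simp add: A_def B_def field_simps)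
      finally show ?thesis
        using x real unfolding mid by (simp add: shrink_real A_def B_def)
    next
      case top
      then show ?thesis
        using sq[OF shrink_nonneg shrink_le_1, of a]
        by (simp add: shrink_top ennreal_mult_top)
    qed
  next
    case top
    then show ?thesis
      using sq[OF shrink_nonneg shrink_le_1, of b]
      by (simp add: shrink_top ennreal_mult_top)
  qed
qed

text \<open>
  The elementary bound \<open>\<bar>t\<bar> \<le> 2 ^ n * t\<^sup>2 + (1/2) ^ n\<close> converts geometric decay of the squared
  \<open>L\<^sup>2\<close> norms into summability of the \<open>L\<^sup>1\<close> norms.
\<close>

lemma (in finite_measure) AE_summable_if_L2_geometric:
  fixes u :: "nat \<Rightarrow> 'a \<Rightarrow> real"
  assumes [measurable]: "\<And>n. u n \<in> borel_measurable M"
    and bound: "\<And>n x. \<bar>u n x\<bar> \<le> 1"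
    and L2: "\<And>n. (\<integral>x. (u n x)\<^sup>2 \<partial>M) \<le> c * (1/4) ^ n"
  shows "AE x in M. summable (\<lambda>n. \<bar>u n x\<bar>)"
proof -
  define m where "m = measure M (space M)"
  have int: "integrable M (\<lambda>x. (u n x)\<^sup>2)" for n
    by (rule integrable_const_bound[of _ 1]) (use bound in \<open>auto simp: abs_square_le_1\<close>)
  have int1: "integrable M (\<lambda>x. \<bar>u n x\<bar>)" for n
    by (rule integrable_const_bound[of _ 1]) (use bound in auto)
  have L1: "(\<integral>x. \<bar>u n x\<bar> \<partial>M) \<le> (c + m) * (1/2) ^ n" for n
  proof -
    have "\<bar>t\<bar> \<le> 2 ^ n * t\<^sup>2 + (1/2) ^ n" for t :: real
    proof -
      have "0 \<le> (2 ^ n * \<bar>t\<bar> - 1)\<^sup>2 + 2 ^ n * \<bar>t\<bar>" by (intro add_nonneg_nonneg) auto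
      also have "\<dots> = 2 ^ n * (2 ^ n * t\<^sup>2 + (1/2) ^ n - \<bar>t\<bar>)"
        by (simp add: power2_eq_square algebra_simps power_one_over flip: abs_mult)
      finally have "0 \<le> 2 ^ n * t\<^sup>2 + (1/2) ^ n - \<bar>t\<bar>"
        using mult_le_cancel_left_pos[of "2 ^ n" 0 "2 ^ n * t\<^sup>2 + (1/2) ^ n - \<bar>t\<bar>"] by simp
      then show ?thesis by simp
    qed
    then have "(\<integral>x. \<bar>u n x\<bar> \<partial>M) \<le> (\<integral>x. 2 ^ n * (u n x)\<^sup>2 + (1/2) ^ n \<partial>M)"
      using int int1 by (intro integral_mono) auto
    also have "\<dots> = 2 ^ n * (\<integral>x. (u n x)\<^sup>2 \<partial>M) + m * (1/2) ^ n"
      using int by (simp add: m_def)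
    also have "\<dots> \<le> 2 ^ n * (c * (1/4) ^ n) + m * (1/2) ^ n"
      using L2 by (intro add_right_mono mult_left_mono) auto
    also have "2 ^ n * (c * (1/4) ^ n) = c * (1/2 :: real) ^ n"
      by (simp add: power_mult_distrib[symmetric] mult.left_commute)
    finally show ?thesis by (simp add: algebra_simps)
  qed
  have "summable (\<lambda>n. (c + m) * (1/2 :: real) ^ n)"
    by (intro summable_mult summable_geometric) auto
  then have s1: "summable (\<lambda>n. \<integral>x. \<bar>u n x\<bar> \<partial>M)"
    by (rule summable_comparison_test'[of _ 0]) (use L1 in auto)
  have "(\<integral>\<^sup>+x. (\<Sum>n. ennreal \<bar>u n x\<bar>) \<partial>M) = (\<Sum>n. \<integral>\<^sup>+x. ennreal \<bar>u n x\<bar> \<partial>M)"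
    by (rule nn_integral_suminf) auto
  also have "\<dots> = (\<Sum>n. ennreal (\<integral>x. \<bar>u n x\<bar> \<partial>M))"
    using int1 by (subst nn_integral_eq_integral) auto
  also have "\<dots> \<noteq> \<infinity>"
    using s1 by (subst suminf_ennreal2) auto
  finally have "AE x in M. (\<Sum>n. ennreal \<bar>u n x\<bar>) \<noteq> \<infinity>"
    by (intro nn_integral_noteq_infinite) auto
  then show ?thesis
    by eventually_elim (auto intro: summable_suminf_not_top)
qed

text \<open>
  Let \<open>J g\<close> be the sum of the integrals of \<open>1 / (1 + g i)\<close>, and let \<open>s\<close> be the supremum, over finite
  intersections, of the infimum of \<open>J\<close>. Choose finite intersections, decreasing in \<open>n\<close>, on which \<open>J\<close>
  exceeds \<open>s - (1/4) ^ n\<close>. Two of their elements at which \<open>J\<close> is below \<open>s + (1/4) ^ n\<close> have a midpoint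
  in the same intersection, so the convexity gap keeps them within \<open>O((1/4) ^ n)\<close> in squared \<open>L\<^sup>2\<close>
  distance, measured after applying \<open>shrink\<close>. Hence almost minimisers converge almost everywhere.
  The limit is independent of the choices: intersecting further with any set of the family does not raise
  the infimum above \<open>s\<close>, so almost minimisers taken from that set as well converge to the same
  limit. This is what handles an uncountable family.
\<close>

lemma (in finite_measure) convex_compactness:
  fixes \<S> :: "('i \<Rightarrow> 'a \<Rightarrow> ennreal) set set"
  assumes I: "finite I"
    and meas: "\<And>S g i. S \<in> \<S> \<Longrightarrow> g \<in> S \<Longrightarrow> i \<in> I \<Longrightarrow> g i \<in> borel_measurable M"
    and mid: "\<And>S g g'. S \<in> \<S> \<Longrightarrow> g \<in> S \<Longrightarrow> g' \<in> S \<Longrightarrow>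
      (\<lambda>i x. ennreal (1/2) * g i x + ennreal (1/2) * g' i x) \<in> S"
    and closed: "\<And>S u g. S \<in> \<S> \<Longrightarrow> (\<And>n. u n \<in> S) \<Longrightarrow> (\<And>i. i \<in> I \<Longrightarrow> g i \<in> borel_measurable M) \<Longrightarrow>
      (AE x in M. \<forall>i\<in>I. (\<lambda>n. u n i x) \<longlonglongrightarrow> g i x) \<Longrightarrow> g \<in> S"
    and fip: "\<And>F. finite F \<Longrightarrow> F \<subseteq> \<S> \<Longrightarrow> \<Inter>F \<noteq> {}"
  shows "\<Inter>\<S> \<noteq> {}"
proof (cases "\<S> = {}")
  case False
  define Fin where "Fin = {F. finite F \<and> F \<noteq> {} \<and> F \<subseteq> \<S>}"
  define J where "J g = (\<Sum>i\<in>I. \<integral>x. shrink (g i x) \<partial>M)" for g :: "'i \<Rightarrow> 'a \<Rightarrow> ennreal"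
  define c where "c = (\<Sum>i\<in>I. measure M (space M))"
  have ne: "\<Inter>F \<noteq> {}" if "F \<in> Fin" for F using fip that by (auto simp: Fin_def)
  have Fin_ne: "Fin \<noteq> {}" using False by (auto simp: Fin_def)
  have meas': "g i \<in> borel_measurable M" if "g \<in> \<Inter>F" "F \<in> Fin" "i \<in> I" for g F i
    using that meas by (auto simp: Fin_def)
  have int: "integrable M (\<lambda>x. shrink (g i x))" if "g \<in> \<Inter>F" "F \<in> Fin" "i \<in> I" for g F i
    using meas'[OF that]
    by (intro integrable_const_bound[of _ 1]) (auto simp: shrink_nonneg shrink_le_1)
  have J_nonneg: "0 \<le> J g" for g
    unfolding J_def by (intro sum_nonneg integral_nonneg) (auto simp: shrink_nonneg)
  have J_le: "J g \<le> c" if "g \<in> \<Inter>F" "F \<in> Fin" for g F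
  proof -
    have "J g \<le> (\<Sum>i\<in>I. \<integral>x. 1 \<partial>M)"
      unfolding J_def using int[OF that] by (intro sum_mono integral_mono) (auto simp: shrink_le_1)
    then show ?thesis by (simp add: c_def)
  qed
  define v where "v F = (INF g\<in>\<Inter>F. J g)" for F
  define s where "s = (SUP F\<in>Fin. v F)"
  have bddb: "bdd_below (J ` A)" for A using J_nonneg by (auto intro!: bdd_belowI2)
  have v_le: "v F \<le> J g" if "g \<in> \<Inter>F" for F g
    unfolding v_def by (rule cINF_lower[OF bddb that])
  have bdda: "bdd_above (v ` Fin)"
  proof (rule bdd_aboveI2)
    fix F assume F: "F \<in> Fin"
    then obtain g where "g \<in> \<Inter>F" using ne by blast
    then show "v F \<le> c" using v_le J_le F by (meson order_trans)
  qed
  have "\<exists>F\<in>Fin. s - (1/4) ^ n < v F" for n :: nat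
    using less_cSUP_iff[OF Fin_ne bdda, of "s - (1/4) ^ n"] by (simp add: s_def)
  then obtain Fs where Fs: "\<And>n. Fs n \<in> Fin" "\<And>n. s - (1/4) ^ n < v (Fs n)" by metis
  define H where "H n = (\<Union>k\<le>n. Fs k)" for n
  have H: "H n \<in> Fin" for n using Fs(1) by (auto simp: H_def Fin_def)
  have H_mono: "\<Inter>(H n) \<subseteq> \<Inter>(H m)" if "m \<le> n" for m n
    unfolding H_def using that by (intro Inf_superset_mono UN_mono) auto
  have lower: "s - (1/4) ^ n < J g" if "g \<in> \<Inter>(H n)" for g n
    using Fs(2)[of n] v_le[of g "Fs n"] that by (force simp: H_def)
  have near: "\<exists>g\<in>\<Inter>F. J g < s + (1/4) ^ n" if "F \<in> Fin" for F and n :: nat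
  proof -
    have "v F \<le> s" unfolding s_def by (rule cSUP_upper[OF that bdda])
    then have "v F < s + (1/4) ^ n" by (simp add: add_strict_increasing2 order_le_less_trans)
    then show ?thesis unfolding v_def using cINF_less_iff[OF ne[OF that] bddb] by blast
  qed
  have r_bd: "\<bar>shrink a - shrink b\<bar> \<le> 1" for a b
    using shrink_nonneg[of a] shrink_le_1[of a] shrink_nonneg[of b] shrink_le_1[of b] by auto
  have gap: "(\<integral>x. (shrink (g i x) - shrink (g' i x))\<^sup>2 \<partial>M) \<le> 8 * (1/4) ^ n"
    if g: "g \<in> \<Inter>(H n)" "J g < s + (1/4) ^ n" and g': "g' \<in> \<Inter>(H n)" "J g' < s + (1/4) ^ n"
      and i: "i \<in> I" for g g' n i
  proof -
    define h where "h = (\<lambda>i x. ennreal (1/2) * g i x + ennreal (1/2) * g' i x)"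
    have h: "h \<in> \<Inter>(H n)"
      using g(1) g'(1) mid H[of n] unfolding h_def Fin_def by blast
    note [measurable] = meas'[OF g(1) H] meas'[OF g'(1) H]
    have int2: "integrable M (\<lambda>x. (shrink (g i x) - shrink (g' i x))\<^sup>2 / 4)" if "i \<in> I" for i
      using that
      by (intro integrable_const_bound[of _ 1] AE_I2)
        (auto simp: abs_square_le_1 r_bd intro: order_trans[of _ 1 4])
    have int3: "integrable M (\<lambda>x. (shrink (g i x) + shrink (g' i x)) / 2 - shrink (h i x))"
      if "i \<in> I" for i
      using int[OF g(1) H that] int[OF g'(1) H that] int[OF h H that] by simp
    have mid_h: "(shrink (g i x) - shrink (g' i x))\<^sup>2 / 4
        \<le> (shrink (g i x) + shrink (g' i x)) / 2 - shrink (h i x)" for i x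
      unfolding h_def by (rule shrink_midpoint)
    have "(\<integral>x. (shrink (g i x) - shrink (g' i x))\<^sup>2 / 4 \<partial>M)
        \<le> (\<Sum>i\<in>I. \<integral>x. (shrink (g i x) - shrink (g' i x))\<^sup>2 / 4 \<partial>M)"
      using I i by (intro member_le_sum) auto
    also have "\<dots> \<le> (\<Sum>i\<in>I. \<integral>x. (shrink (g i x) + shrink (g' i x)) / 2 - shrink (h i x) \<partial>M)"
      by (intro sum_mono integral_mono int2 int3 mid_h)
    also have "\<dots> = (J g + J g') / 2 - J h"
      using int[OF g(1) H] int[OF g'(1) H] int[OF h H]
      by (simp add: J_def sum.distrib sum_subtractf add_divide_distrib sum_divide_distrib)
    also have "\<dots> \<le> 2 * (1/4) ^ n"
      using g(2) g'(2) lower[OF h] by (simp add: field_simps)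
    finally show ?thesis by simp
  qed
  have "\<forall>n. \<exists>g. g \<in> \<Inter>(H n) \<and> J g < s + (1/4) ^ n"
    using near[OF H] by blast
  then obtain g where g: "\<And>n. g n \<in> \<Inter>(H n)" "\<And>n. J (g n) < s + (1/4) ^ n"
    unfolding choice_iff by blast
  note [measurable] = meas'[OF g(1) H]
  define r where "r n i x = shrink (g n i x)" for n i x
  have r_meas[measurable]: "i \<in> I \<Longrightarrow> r n i \<in> borel_measurable M" for n i
    unfolding r_def by measurable
  define \<rho> where "\<rho> i x = lim (\<lambda>n. r n i x)" for i x
  have r_lim: "AE x in M. (\<lambda>n. r n i x) \<longlonglongrightarrow> \<rho> i x" if i: "i \<in> I" for i
  proof -
    have "AE x in M. summable (\<lambda>n. \<bar>r (Suc n) i x - r n i x\<bar>)"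
    proof (rule AE_summable_if_L2_geometric[where c = 8])
      fix n
      have "(1/4) ^ Suc n \<le> (1/4 :: real) ^ n" by (rule power_decreasing) auto
      with g(2)[of "Suc n"] have "J (g (Suc n)) < s + (1/4) ^ n" by linarith
      moreover have "g (Suc n) \<in> \<Inter>(H n)" using g(1)[of "Suc n"] H_mono[of n "Suc n"] by auto
      ultimately show "(\<integral>x. (r (Suc n) i x - r n i x)\<^sup>2 \<partial>M) \<le> 8 * (1/4) ^ n"
        unfolding r_def by (intro gap g i)
    qed (use i r_bd in \<open>auto simp: r_def\<close>)
    then show ?thesis
    proof eventually_elim
      case (elim x)
      then have "summable (\<lambda>n. r (Suc n) i x - r n i x)" by (rule summable_rabs_cancel)
      then have "(\<lambda>n. (\<Sum>k<n. r (Suc k) i x - r k i x) + r 0 i x) \<longlonglongrightarrow>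
          (\<Sum>k. r (Suc k) i x - r k i x) + r 0 i x"
        by (intro tendsto_intros summable_LIMSEQ)
      then have "convergent (\<lambda>n. r n i x)"
        unfolding sum_lessThan_telescope[of "\<lambda>n. r n i x"] by (auto intro: convergentI)
      then show ?case unfolding \<rho>_def by (simp add: convergent_LIMSEQ_iff)
    qed
  qed
  (* The inverse function of shrink, applied to the limit. *)
  define G where "G i x = inverse (ennreal (\<rho> i x)) - 1" for i x
  have lim_G: "(\<lambda>n. u n) \<longlonglongrightarrow> G i x" if "(\<lambda>n. shrink (u n)) \<longlonglongrightarrow> \<rho> i x" for u i x
  proof -
    have "(\<lambda>n. inverse (ennreal (shrink (u n)))) \<longlonglongrightarrow> inverse (ennreal (\<rho> i x))"
      using that
      by (intro continuous_on_tendsto_compose[of UNIV inverse] continuous_on_inverse_ennreal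
          continuous_on_id tendsto_ennrealI) auto
    then have "(\<lambda>n. inverse (ennreal (shrink (u n))) - 1) \<longlonglongrightarrow> inverse (ennreal (\<rho> i x)) - 1"
      by (intro tendsto_diff_ennreal_general tendsto_const) auto
    then show ?thesis by (simp add: shrink_inverse G_def)
  qed
  have G_meas: "G i \<in> borel_measurable M" if [measurable]: "i \<in> I" for i
    unfolding G_def \<rho>_def by measurable
  have "G \<in> S" if S: "S \<in> \<S>" for S
  proof -
    have SH: "insert S (H n) \<in> Fin" for n using H[of n] S by (auto simp: Fin_def)
    have "\<forall>n. \<exists>g'. g' \<in> \<Inter>(insert S (H n)) \<and> J g' < s + (1/4) ^ n"
      using near[OF SH] by blast
    then obtain g' where g': "\<And>n. g' n \<in> \<Inter>(insert S (H n))" "\<And>n. J (g' n) < s + (1/4) ^ n"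
      unfolding choice_iff by blast
    have [measurable]: "i \<in> I \<Longrightarrow> g' n i \<in> borel_measurable M" for n i
      using meas'[OF g'(1) SH] .
    have "AE x in M. (\<lambda>n. g' n i x) \<longlonglongrightarrow> G i x" if i: "i \<in> I" for i
    proof -
      have "AE x in M. summable (\<lambda>n. \<bar>shrink (g' n i x) - r n i x\<bar>)"
      proof (rule AE_summable_if_L2_geometric[where c = 8])
        show "(\<integral>x. (shrink (g' n i x) - r n i x)\<^sup>2 \<partial>M) \<le> 8 * (1/4) ^ n" for n
          unfolding r_def using g' by (intro gap g i) auto
      qed (use i r_bd in \<open>auto simp: r_def\<close>)
      with r_lim[OF i] show ?thesis
      proof eventually_elim
        case (elim x)
        have "(\<lambda>n. (shrink (g' n i x) - r n i x) + r n i x) \<longlonglongrightarrow> 0 + \<rho> i x"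
          by (intro tendsto_add elim summable_LIMSEQ_zero summable_rabs_cancel)
        then show ?case by (intro lim_G) simp
      qed
    qed
    then have "AE x in M. \<forall>i\<in>I. (\<lambda>n. g' n i x) \<longlonglongrightarrow> G i x"
      using I by (simp add: AE_finite_all)
    then show ?thesis using g'(1) by (intro closed[OF S _ G_meas]) auto
  qed
  then show ?thesis by blast
qed auto

section \<open>Norms of simple functions\<close>

lemma weighted_arith_geo_mean:
  fixes \<alpha> x :: "'i \<Rightarrow> real"
  assumes "finite I" and \<alpha>: "\<And>i. i \<in> I \<Longrightarrow> 0 < \<alpha> i" and sum: "(\<Sum>i\<in>I. \<alpha> i) = 1"
    and x: "\<And>i. i \<in> I \<Longrightarrow> 0 \<le> x i"
  shows "(\<Prod>i\<in>I. x i powr \<alpha> i) \<le> (\<Sum>i\<in>I. \<alpha> i * x i)"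
proof (cases "\<exists>i\<in>I. x i = 0")
  case True
  then have "(\<Prod>i\<in>I. x i powr \<alpha> i) = 0" using \<open>finite I\<close> by (auto simp: prod_zero_iff)
  also have "0 \<le> (\<Sum>i\<in>I. \<alpha> i * x i)"
    by (intro sum_nonneg mult_nonneg_nonneg less_imp_le[OF \<alpha>] x)
  finally show ?thesis .
next
  case False
  then have pos: "0 < x i" if "i \<in> I" for i using x[OF that] that by (auto simp: less_le)
  have ne: "I \<noteq> {}" using sum by auto
  have "exp (\<Sum>i\<in>I. \<alpha> i *\<^sub>R ln (x i)) \<le> (\<Sum>i\<in>I. \<alpha> i * exp (ln (x i)))"
    using assms(1) ne exp_convex sum \<alpha> by (intro convex_on_sum[where C = UNIV]) (auto intro: less_imp_le)
  also have "(\<Sum>i\<in>I. \<alpha> i * exp (ln (x i))) = (\<Sum>i\<in>I. \<alpha> i * x i)"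
    using pos by simp
  also have "exp (\<Sum>i\<in>I. \<alpha> i *\<^sub>R ln (x i)) = (\<Prod>i\<in>I. x i powr \<alpha> i)"
    using pos assms(1) by (subst exp_sum) (force simp: powr_def intro!: prod.cong)+
  finally show ?thesis .
qed

lemma ennreal_power_le_iff:
  assumes "0 < a" "0 \<le> r"
  shows "ennreal_power t (1 / a) \<le> ennreal r \<longleftrightarrow> t \<le> ennreal (r powr a)"
proof (cases t)
  case (real s)
  have "s powr (1 / a) \<le> r \<longleftrightarrow> s \<le> r powr a"
  proof
    assume "s powr (1 / a) \<le> r"
    then have "(s powr (1 / a)) powr a \<le> r powr a" using assms by (intro powr_mono2) auto
    then show "s \<le> r powr a" using assms real by (cases "s = 0") (auto simp: powr_powr)
  next
    assume "s \<le> r powr a"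
    then have "s powr (1 / a) \<le> (r powr a) powr (1 / a)" using assms real by (intro powr_mono2) auto
    then show "s powr (1 / a) \<le> r" using assms by (cases "r = 0") (auto simp: powr_powr)
  qed
  then show ?thesis using real assms by (simp add: ennreal_power_def)
next
  case top
  then show ?thesis by (simp add: ennreal_power_def top_unique)
qed

lemma ennreal_power_le_1: "t \<le> 1 \<Longrightarrow> 0 < a \<Longrightarrow> ennreal_power t a \<le> 1"
  using ennreal_power_le_iff[of "1 / a" 1 t] by simp

lemma Lp_norm_le_iff:
  assumes "1 \<le> p" "p \<noteq> \<infinity>" "0 \<le> r"
  shows "Lp_norm p M f \<le> ennreal r \<longleftrightarrow>
    (\<integral>\<^sup>+x. ennreal (\<bar>f x\<bar> powr enn2real p) \<partial>M) \<le> ennreal (r powr enn2real p)"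
proof -
  have "0 < enn2real p" using assms by (cases p) auto
  then show ?thesis unfolding Lp_norm_def using assms by (simp add: ennreal_power_le_iff)
qed

lemma Lp_norm_top_le_iff:
  assumes "f \<in> borel_measurable M"
  shows "Lp_norm top M f \<le> c \<longleftrightarrow> (AE x in M. ennreal \<bar>f x\<bar> \<le> c)"
proof
  assume "Lp_norm top M f \<le> c"
  then show "AE x in M. ennreal \<bar>f x\<bar> \<le> c"
    using esssup_AE[where M = M and f = "\<lambda>x. ennreal \<bar>f x\<bar>"]
    by (auto simp: Lp_norm_def elim!: eventually_mono)
next
  assume "AE x in M. ennreal \<bar>f x\<bar> \<le> c"
  then show "Lp_norm top M f \<le> c" using assms by (auto simp: Lp_norm_def intro!: esssup_I)
qed

lemma Lp_norm_abs: "Lp_norm p M (\<lambda>x. \<bar>f x\<bar>) = Lp_norm p M f"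
  by (simp add: Lp_norm_def)

lemma Lp_norm_zero: "Lp_norm p M (\<lambda>x. 0) = 0"
  using Lp_norm_top_le_iff[of "\<lambda>x. 0" M 0] by (auto simp: Lp_norm_def ennreal_power_def)

lemma Lp_norm_divide_le_1:
  assumes p: "1 \<le> p" and f: "f \<in> borel_measurable M" and r: "0 < r" "Lp_norm p M f \<le> ennreal r"
  shows "Lp_norm p M (\<lambda>x. (1 / r) * f x) \<le> 1"
proof (cases "p = \<infinity>")
  case True
  then show ?thesis
    using f r Lp_norm_top_le_iff[of f M "ennreal r"] Lp_norm_top_le_iff[of "\<lambda>x. (1 / r) * f x" M 1]
    by (auto simp: abs_mult ennreal_le_1 elim!: eventually_mono)
next
  case False
  let ?P = "enn2real p"
  have "(\<integral>\<^sup>+x. ennreal (\<bar>(1 / r) * f x\<bar> powr ?P) \<partial>M)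
      = (\<integral>\<^sup>+x. ennreal ((1 / r) powr ?P) * ennreal (\<bar>f x\<bar> powr ?P) \<partial>M)"
    using r by (intro nn_integral_cong) (auto simp: abs_mult powr_mult ennreal_mult[symmetric] powr_divide)
  also have "\<dots> = ennreal ((1 / r) powr ?P) * (\<integral>\<^sup>+x. ennreal (\<bar>f x\<bar> powr ?P) \<partial>M)"
    using f by (intro nn_integral_cmult) auto
  also have "\<dots> \<le> ennreal ((1 / r) powr ?P) * ennreal (r powr ?P)"
    using Lp_norm_le_iff[of p r M f] p False r by (intro mult_left_mono) auto
  also have "\<dots> = 1" using r by (simp add: ennreal_mult[symmetric] powr_mult[symmetric])
  finally show ?thesis using Lp_norm_le_iff[of p 1 M] p False by simp
qed

text \<open>
  Convexity of \<open>t powr p\<close> on the closed half-line. If one of the points is \<open>0\<close>, it is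
  \<open>m powr p \<le> m\<close> for \<open>m\<close> in \<open>[0,1]\<close>.
\<close>

lemma powr_convex_nonneg:
  fixes x y l p :: real
  assumes "1 \<le> p" "0 \<le> x" "0 \<le> y" "0 \<le> l" "l \<le> 1"
  shows "(l * x + (1 - l) * y) powr p \<le> l * x powr p + (1 - l) * y powr p"
proof -
  have scale: "(m * z) powr p \<le> m * z powr p" if "0 \<le> m" "m \<le> 1" "0 \<le> z" for m z :: real
  proof (cases "m = 0")
    case False
    have "m powr p \<le> m powr 1" using that False assms by (intro powr_mono') auto
    then show ?thesis using that by (auto simp: powr_mult intro!: mult_right_mono)
  qed auto
  consider "x = 0" | "y = 0" | "0 < x" "0 < y" using assms by linarith
  then show ?thesis
  proof cases
    case 1
    then show ?thesis using scale[of "1 - l" y] assms by auto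
  next
    case 2
    then show ?thesis using scale[of l x] assms by auto
  next
    case 3
    then show ?thesis
      using convex_onD[OF powr_convex[OF assms(1)], of "1 - l" x y] assms by auto
  qed
qed

text \<open>
  For finite \<open>p\<close> the unit ball is a sublevel set of the integral of \<open>\<bar>f\<bar> powr p\<close>, which is a convex
  function of \<open>f\<close>.
\<close>

lemma Lp_unit_ball_convex:
  assumes p: "1 \<le> p" and f: "f \<in> borel_measurable M" "Lp_norm p M f \<le> 1"
    and g: "g \<in> borel_measurable M" "Lp_norm p M g \<le> 1" and l: "0 \<le> l" "l \<le> 1"
  shows "Lp_norm p M (\<lambda>x. l * f x + (1 - l) * g x) \<le> 1"
proof -
  have tri: "\<bar>l * a + (1 - l) * b\<bar> \<le> l * \<bar>a\<bar> + (1 - l) * \<bar>b\<bar>" for a b :: real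
    using l abs_triangle_ineq[of "l * a" "(1 - l) * b"] by (simp add: abs_mult)
  show ?thesis
  proof (cases "p = \<infinity>")
    case True
    have "AE x in M. \<bar>f x\<bar> \<le> 1" "AE x in M. \<bar>g x\<bar> \<le> 1"
      using f g True by (auto simp: Lp_norm_top_le_iff)
    then have "AE x in M. \<bar>l * f x + (1 - l) * g x\<bar> \<le> 1"
    proof eventually_elim
      case (elim x)
      then have "l * \<bar>f x\<bar> + (1 - l) * \<bar>g x\<bar> \<le> l * 1 + (1 - l) * 1"
        using l by (intro add_mono mult_left_mono) auto
      then show ?case using tri[of "f x" "g x"] by simp
    qed
    then show ?thesis using True f g by (auto simp: Lp_norm_top_le_iff)
  next
    case False
    let ?P = "enn2real p"
    have P: "1 \<le> ?P" using p False by (cases p) auto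
    have pt: "\<bar>l * a + (1 - l) * b\<bar> powr ?P \<le> l * \<bar>a\<bar> powr ?P + (1 - l) * \<bar>b\<bar> powr ?P" for a b
      using tri[of a b] P l
      by (intro order_trans[OF powr_mono2 powr_convex_nonneg]) auto
    have "(\<integral>\<^sup>+x. ennreal (\<bar>l * f x + (1 - l) * g x\<bar> powr ?P) \<partial>M)
        \<le> (\<integral>\<^sup>+x. ennreal l * ennreal (\<bar>f x\<bar> powr ?P) + ennreal (1 - l) * ennreal (\<bar>g x\<bar> powr ?P) \<partial>M)"
      using l pt by (intro nn_integral_mono)
        (auto simp: ennreal_mult[symmetric] ennreal_plus[symmetric] simp del: ennreal_plus intro!: ennreal_leI)
    also have "\<dots> = ennreal l * (\<integral>\<^sup>+x. ennreal (\<bar>f x\<bar> powr ?P) \<partial>M)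
        + ennreal (1 - l) * (\<integral>\<^sup>+x. ennreal (\<bar>g x\<bar> powr ?P) \<partial>M)"
      using f g by (simp add: nn_integral_add nn_integral_cmult)
    also have "\<dots> \<le> ennreal l * 1 + ennreal (1 - l) * 1"
      using f g Lp_norm_le_iff[of p 1 M] p False by (intro add_mono mult_left_mono) auto
    also have "\<dots> = 1" using l by (simp flip: ennreal_plus)
    finally show ?thesis using Lp_norm_le_iff[of p 1 M] p False by simp
  qed
qed

lemma simple_functions_measurable: "f \<in> simple_functions M \<Longrightarrow> f \<in> borel_measurable M"
  by (auto simp: simple_functions_def intro: borel_measurable_simple_function)

lemma simple_functions_compose:
  assumes "f \<in> simple_functions M" "h 0 = 0"
  shows "(\<lambda>x. h (f x)) \<in> simple_functions M"
proof -
  have [measurable]: "f \<in> borel_measurable M" using assms by (intro simple_functions_measurable)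
  have "emeasure M {y \<in> space M. h (f y) \<noteq> 0} \<le> emeasure M {y \<in> space M. f y \<noteq> 0}"
    using assms by (intro emeasure_mono) auto
  then show ?thesis using assms
    by (auto simp: simple_functions_def intro!: simple_function_compose1[where g = h])
qed

lemma simple_functions_add:
  assumes "f \<in> simple_functions M" "g \<in> simple_functions M"
  shows "(\<lambda>x. f x + g x) \<in> simple_functions M"
proof -
  have [measurable]: "f \<in> borel_measurable M" "g \<in> borel_measurable M"
    using assms by (auto intro: simple_functions_measurable)
  have "emeasure M {y \<in> space M. f y + g y \<noteq> 0}
      \<le> emeasure M ({y \<in> space M. f y \<noteq> 0} \<union> {y \<in> space M. g y \<noteq> 0})"
    by (intro emeasure_mono) auto
  also have "\<dots> \<le> emeasure M {y \<in> space M. f y \<noteq> 0} + emeasure M {y \<in> space M. g y \<noteq> 0}"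
    by (intro emeasure_subadditive) auto
  also have "\<dots> < \<infinity>" using assms by (auto simp: simple_functions_def)
  finally show ?thesis using assms by (auto simp: simple_functions_def)
qed

lemma Lp_norm_simple_function_finite:
  assumes p: "1 \<le> p" and f: "f \<in> simple_functions M"
  shows "Lp_norm p M f < \<infinity>"
proof -
  have [measurable]: "f \<in> borel_measurable M" using f by (rule simple_functions_measurable)
  have "finite (f ` space M)" using f by (auto simp: simple_functions_def simple_function_def)
  then have "bounded (f ` space M)" by (rule finite_imp_bounded)
  then obtain c where c: "0 < c" "\<And>x. x \<in> space M \<Longrightarrow> \<bar>f x\<bar> \<le> c"
    by (auto simp: bounded_pos)
  show ?thesis
  proof (cases "p = \<infinity>")
    case True
    have "Lp_norm p M f \<le> ennreal c"
      using c True by (auto simp: Lp_norm_top_le_iff intro!: AE_I2 ennreal_leI)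
    then show ?thesis by (auto simp: less_top[symmetric] top_unique)
  next
    case False
    let ?P = "enn2real p" and ?S = "{y \<in> space M. f y \<noteq> 0}"
    have S: "emeasure M ?S < \<infinity>" using f by (auto simp: simple_functions_def)
    have "(\<integral>\<^sup>+x. ennreal (\<bar>f x\<bar> powr ?P) \<partial>M) \<le> (\<integral>\<^sup>+x. ennreal (c powr ?P) * indicator ?S x \<partial>M)"
      using c p by (intro nn_integral_mono)
        (auto simp: indicator_def intro!: ennreal_leI powr_mono2)
    also have "\<dots> = ennreal (c powr ?P) * emeasure M ?S"
      by (subst nn_integral_cmult_indicator) auto
    also have "\<dots> < \<infinity>" using S by (simp add: ennreal_mult_less_top)
    finally show ?thesis using False by (auto simp: Lp_norm_def ennreal_power_def)
  qed
qed

lemma conjugate_exponents_cases: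
  fixes q q' :: ennreal
  assumes "1 \<le> q" "1 / q + 1 / q' = 1"
  obtains "q = 1" "q' = \<infinity>" | "q = \<infinity>" "q' = 1"
  | Q Q' where "q = ennreal Q" "q' = ennreal Q'" "1 < Q" "1 < Q'" "1 / Q + 1 / Q' = 1"
proof (cases q)
  case top
  then have "inverse q' = 1" using assms by (simp add: divide_ennreal_def)
  then have "q' = 1"
  proof (cases q')
    case (real r)
    then have "0 < r" using \<open>inverse q' = 1\<close> by (cases "r = 0") auto
    then have "ennreal (inverse r) = ennreal 1"
      using \<open>inverse q' = 1\<close> real by (simp add: inverse_ennreal)
    then have "inverse r = 1" using \<open>0 < r\<close> by (subst (asm) ennreal_inj) auto
    then show ?thesis using real by simp
  qed simp
  then show ?thesis using that top by simp
next
  case (real Q)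
  then have Q: "1 \<le> Q" using assms by simp
  then have q: "1 / q = ennreal (1 / Q)" using real by (simp add: divide_ennreal[symmetric])
  show ?thesis
  proof (cases q')
    case top
    then have "ennreal (1 / Q) = 1" using assms q by (simp add: divide_ennreal_def)
    then have "Q = 1" using Q by (simp add: ennreal_eq_1)
    then show ?thesis using that top real by simp
  next
    case (real Q')
    have "Q' \<noteq> 0"
    proof
      assume "Q' = 0"
      then show False using assms(2) real by (simp add: divide_ennreal_def)
    qed
    then have Q': "0 < Q'" using real by simp
    have "1 / q' = ennreal (1 / Q')" using real Q' by (simp add: divide_ennreal[symmetric])
    then have "ennreal (1 / Q + 1 / Q') = ennreal 1" using assms(2) q Q Q' by (simp add: ennreal_plus)
    then have eq: "1 / Q + 1 / Q' = 1" using Q Q' by (subst (asm) ennreal_inj) auto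
    have "0 < 1 / Q" "0 < 1 / Q'" using Q Q' by auto
    with eq have "1 / Q < 1" "1 / Q' < 1" by linarith+
    then have "1 < Q" "1 < Q'" using Q Q' by (auto simp: field_simps)
    then show ?thesis using that eq real \<open>q = ennreal Q\<close> by blast
  qed
qed

text \<open>
  For exponents other than \<open>1\<close> and \<open>\<infinity>\<close> this integrates Young's inequality for \<open>\<bar>F\<bar> / N\<close> and
  \<open>\<bar>G\<bar> / N'\<close>, where \<open>N\<close> and \<open>N'\<close> are the two norms.
\<close>

lemma nn_integral_Holder:
  assumes [measurable]: "F \<in> borel_measurable M" "G \<in> borel_measurable M"
    and q: "1 \<le> q" "1 / q + 1 / q' = 1"
    and fin: "Lp_norm q M F < \<infinity>" "Lp_norm q' M G < \<infinity>"
  shows "(\<integral>\<^sup>+x. ennreal (\<bar>G x\<bar> * \<bar>F x\<bar>) \<partial>M) \<le> Lp_norm q' M G * Lp_norm q M F"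
proof -
  have extreme: "(\<integral>\<^sup>+x. ennreal (\<bar>g x\<bar> * \<bar>f x\<bar>) \<partial>M) \<le> Lp_norm top M g * Lp_norm 1 M f"
    if [measurable]: "f \<in> borel_measurable M" "g \<in> borel_measurable M"
      and fin: "Lp_norm 1 M f < \<infinity>" for f g :: "'a \<Rightarrow> real"
  proof -
    have "AE x in M. ennreal \<bar>g x\<bar> \<le> Lp_norm top M g" using Lp_norm_top_le_iff[of g M] by auto
    then have "(\<integral>\<^sup>+x. ennreal (\<bar>g x\<bar> * \<bar>f x\<bar>) \<partial>M) \<le> (\<integral>\<^sup>+x. Lp_norm top M g * ennreal \<bar>f x\<bar> \<partial>M)"
      by (intro nn_integral_mono_AE) (auto simp: ennreal_mult elim!: eventually_mono intro: mult_right_mono)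
    also have "\<dots> = Lp_norm top M g * (\<integral>\<^sup>+x. ennreal \<bar>f x\<bar> \<partial>M)" by (intro nn_integral_cmult) auto
    also have "(\<integral>\<^sup>+x. ennreal \<bar>f x\<bar> \<partial>M) = Lp_norm 1 M f"
      using fin by (auto simp: Lp_norm_def ennreal_power_def less_top split: if_splits)
    finally show ?thesis .
  qed
  from q show ?thesis
  proof (cases rule: conjugate_exponents_cases)
    case 1
    then show ?thesis using extreme[of F G] fin by auto
  next
    case 2
    then show ?thesis using extreme[of G F] fin by (auto simp: mult.commute)
  next
    case (3 Q Q')
    let ?a = "\<integral>\<^sup>+x. ennreal (\<bar>F x\<bar> powr Q) \<partial>M" and ?b = "\<integral>\<^sup>+x. ennreal (\<bar>G x\<bar> powr Q') \<partial>M"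
    have zero: "(\<integral>\<^sup>+x. ennreal (\<bar>G x\<bar> * \<bar>F x\<bar>) \<partial>M) = 0" if "?a = 0 \<or> ?b = 0"
    proof -
      have "AE x in M. F x = 0 \<or> G x = 0"
        using that by (auto simp: nn_integral_0_iff_AE elim: eventually_mono)
      then have "(\<integral>\<^sup>+x. ennreal (\<bar>G x\<bar> * \<bar>F x\<bar>) \<partial>M) = (\<integral>\<^sup>+x. 0 \<partial>M)"
        by (intro nn_integral_cong_AE) (auto elim!: eventually_mono)
      then show ?thesis by simp
    qed
    have norms: "Lp_norm q M F = ennreal_power ?a (1 / Q)" "Lp_norm q' M G = ennreal_power ?b (1 / Q')"
      using 3 by (auto simp: Lp_norm_def)
    have "?a \<noteq> \<infinity>" "?b \<noteq> \<infinity>" using fin norms by (auto simp: ennreal_power_def)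
    then obtain a b where ab: "?a = ennreal a" "?b = ennreal b" "0 \<le> a" "0 \<le> b"
      by (cases ?a; cases ?b) auto
    show ?thesis
    proof (cases "a = 0 \<or> b = 0")
      case True
      then show ?thesis using zero ab by auto
    next
      case False
      define N N' where "N = a powr (1 / Q)" and "N' = b powr (1 / Q')"
      have pos: "0 < a" "0 < b" using False ab by auto
      then have NN: "0 < N" "0 < N'" by (auto simp: N_def N'_def)
      have pw: "N powr Q = a" "N' powr Q' = b" using 3 pos by (auto simp: N_def N'_def powr_powr)
      have young: "\<bar>G x\<bar> * \<bar>F x\<bar>
          \<le> N * N' / (Q * a) * \<bar>F x\<bar> powr Q + N * N' / (Q' * b) * \<bar>G x\<bar> powr Q'" for x
      proof -
        have "(\<bar>F x\<bar> / N) * (\<bar>G x\<bar> / N') \<le> (\<bar>F x\<bar> / N) powr Q / Q + (\<bar>G x\<bar> / N') powr Q' / Q'"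
          using 3 NN by (intro Youngs_inequality) auto
        then have "N * N' * ((\<bar>F x\<bar> / N) * (\<bar>G x\<bar> / N'))
            \<le> N * N' * ((\<bar>F x\<bar> / N) powr Q / Q + (\<bar>G x\<bar> / N') powr Q' / Q')"
          using NN by (intro mult_left_mono) auto
        then show ?thesis using NN by (simp add: powr_divide pw algebra_simps)
      qed
      have "(\<integral>\<^sup>+x. ennreal (\<bar>G x\<bar> * \<bar>F x\<bar>) \<partial>M)
          \<le> (\<integral>\<^sup>+x. ennreal (N * N' / (Q * a)) * ennreal (\<bar>F x\<bar> powr Q)
                + ennreal (N * N' / (Q' * b)) * ennreal (\<bar>G x\<bar> powr Q') \<partial>M)"
        using 3 NN pos young by (intro nn_integral_mono)
          (auto simp: ennreal_mult[symmetric] ennreal_plus[symmetric] simp del: ennreal_plus intro!: ennreal_leI)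
      also have "\<dots> = ennreal (N * N' / (Q * a)) * ?a + ennreal (N * N' / (Q' * b)) * ?b"
        by (simp add: nn_integral_add nn_integral_cmult)
      also have "\<dots> = ennreal (N * N' / (Q * a) * a + N * N' / (Q' * b) * b)"
        using 3 NN pos unfolding ab by (simp add: ennreal_mult[symmetric] ennreal_plus[symmetric] del: ennreal_plus)
      also have "N * N' / (Q * a) * a + N * N' / (Q' * b) * b = N * N' * (1 / Q + 1 / Q')"
        using pos by (simp add: distrib_left)
      also have "ennreal \<dots> = Lp_norm q' M G * Lp_norm q M F"
        using 3 NN ab unfolding norms by (simp add: ennreal_power_def N_def N'_def ennreal_mult[symmetric] mult.commute)
      finally show ?thesis .
    qed
  qed
qed

section \<open>Domination by a weighted geometric mean\<close>

locale convex_weights =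
  fixes I :: "'i set" and \<alpha> :: "'i \<Rightarrow> real"
  assumes finite_I: "finite I"
    and \<alpha>_pos: "\<And>i. i \<in> I \<Longrightarrow> 0 < \<alpha> i"
    and \<alpha>_sum: "(\<Sum>i\<in>I. \<alpha> i) = 1"
begin

text \<open>
  The inequality \<open>c \<le> (\<Prod>i\<in>I. \<gamma> i powr \<alpha> i)\<close> in dual form. As a family of linear inequalities in \<open>\<gamma>\<close> it
  is visibly convex and closed, and it keeps a meaning when some \<open>\<gamma> i\<close> is \<open>0\<close> and another is \<open>\<infinity>\<close>.
\<close>

definition geo_dominates :: "real \<Rightarrow> ('i \<Rightarrow> ennreal) \<Rightarrow> bool" where
  "geo_dominates c \<gamma> \<longleftrightarrow>
    (\<forall>t. (\<forall>i\<in>I. 0 < t i) \<longrightarrow>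
      ennreal (c * (\<Prod>i\<in>I. t i powr \<alpha> i)) \<le> (\<Sum>i\<in>I. ennreal (\<alpha> i * t i) * \<gamma> i))"

lemma geo_dominates_convex:
  assumes "geo_dominates c \<gamma>" "geo_dominates c \<gamma>'" and l: "0 \<le> l" "l \<le> 1"
  shows "geo_dominates c (\<lambda>i. ennreal l * \<gamma> i + ennreal (1 - l) * \<gamma>' i)"
  unfolding geo_dominates_def
proof (intro allI impI)
  fix t :: "'i \<Rightarrow> real" assume t: "\<forall>i\<in>I. 0 < t i"
  let ?s = "ennreal (c * (\<Prod>i\<in>I. t i powr \<alpha> i))"
  have "ennreal l + ennreal (1 - l) = 1" using l by (simp flip: ennreal_plus)
  then have "?s = ennreal l * ?s + ennreal (1 - l) * ?s" by (metis distrib_right mult_1)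
  also have "\<dots> \<le> ennreal l * (\<Sum>i\<in>I. ennreal (\<alpha> i * t i) * \<gamma> i)
      + ennreal (1 - l) * (\<Sum>i\<in>I. ennreal (\<alpha> i * t i) * \<gamma>' i)"
    using assms(1,2) t by (intro add_mono mult_left_mono) (auto simp: geo_dominates_def)
  also have "\<dots> = (\<Sum>i\<in>I. ennreal (\<alpha> i * t i) * (ennreal l * \<gamma> i + ennreal (1 - l) * \<gamma>' i))"
    by (simp add: sum_distrib_left sum.distrib distrib_left mult_ac)
  finally show "?s \<le> (\<Sum>i\<in>I. ennreal (\<alpha> i * t i) * (ennreal l * \<gamma> i + ennreal (1 - l) * \<gamma>' i))" .
qed

lemma geo_dominates_limit:
  assumes dom: "\<And>n. geo_dominates c (u n)" and lim: "\<And>i. i \<in> I \<Longrightarrow> (\<lambda>n. u n i) \<longlonglongrightarrow> \<gamma> i"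
  shows "geo_dominates c \<gamma>"
  unfolding geo_dominates_def
proof (intro allI impI)
  fix t :: "'i \<Rightarrow> real" assume t: "\<forall>i\<in>I. 0 < t i"
  have "(\<lambda>n. \<Sum>i\<in>I. ennreal (\<alpha> i * t i) * u n i) \<longlonglongrightarrow> (\<Sum>i\<in>I. ennreal (\<alpha> i * t i) * \<gamma> i)"
    using lim by (intro tendsto_sum ennreal_tendsto_cmult) auto
  then show "ennreal (c * (\<Prod>i\<in>I. t i powr \<alpha> i)) \<le> (\<Sum>i\<in>I. ennreal (\<alpha> i * t i) * \<gamma> i)"
    by (rule LIMSEQ_le_const) (use dom t in \<open>auto simp: geo_dominates_def\<close>)
qed

text \<open>
  The optimal test is \<open>t i = 1 / r i\<close>. As \<open>r i\<close> may vanish, \<open>t i = 1 / (r i + e)\<close> is used instead and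
  \<open>e\<close> tends to \<open>0\<close>.
\<close>

lemma geo_dominates_real:
  assumes dom: "geo_dominates c (\<lambda>i. ennreal (r i))" and r: "\<And>i. i \<in> I \<Longrightarrow> 0 \<le> r i" and c: "0 \<le> c"
  shows "c \<le> (\<Prod>i\<in>I. r i powr \<alpha> i)"
proof -
  have *: "c \<le> (\<Prod>i\<in>I. (r i + e) powr \<alpha> i)" if e: "0 < e" for e
  proof -
    define t where "t i = 1 / (r i + e)" for i
    have t: "0 < t i" "t i * r i \<le> 1" if "i \<in> I" for i
      using r[OF that] e by (auto simp: t_def add_nonneg_pos field_simps)
    have "ennreal (c * (\<Prod>i\<in>I. t i powr \<alpha> i)) \<le> (\<Sum>i\<in>I. ennreal (\<alpha> i * t i) * ennreal (r i))"
      using dom t(1) by (auto simp: geo_dominates_def)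
    also have "\<dots> = ennreal (\<Sum>i\<in>I. \<alpha> i * t i * r i)"
      using t(1) \<alpha>_pos r by (subst sum_ennreal[symmetric])
        (auto simp: ennreal_mult less_imp_le intro!: sum.cong)
    also have "\<dots> \<le> ennreal (\<Sum>i\<in>I. \<alpha> i * 1)"
      using t(2) less_imp_le[OF \<alpha>_pos] unfolding mult.assoc
      by (intro ennreal_leI sum_mono mult_left_mono) auto
    finally have le: "c * (\<Prod>i\<in>I. t i powr \<alpha> i) \<le> 1" by (simp add: \<alpha>_sum ennreal_le_1)
    have inv: "(\<Prod>i\<in>I. t i powr \<alpha> i) * (\<Prod>i\<in>I. (r i + e) powr \<alpha> i) = 1"
    proof -
      have "t i powr \<alpha> i * (r i + e) powr \<alpha> i = 1" if "i \<in> I" for i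
        using r[OF that] e by (simp add: t_def powr_divide add_nonneg_pos[THEN less_imp_neq, symmetric])
      then show ?thesis by (simp flip: prod.distrib)
    qed
    have "c = c * (\<Prod>i\<in>I. t i powr \<alpha> i) * (\<Prod>i\<in>I. (r i + e) powr \<alpha> i)"
      by (simp add: mult.assoc inv)
    also have "\<dots> \<le> 1 * (\<Prod>i\<in>I. (r i + e) powr \<alpha> i)"
      by (intro mult_right_mono le prod_nonneg) auto
    finally show ?thesis by simp
  qed
  have "(\<lambda>n. \<Prod>i\<in>I. (r i + 1 / real (Suc n)) powr \<alpha> i) \<longlonglongrightarrow> (\<Prod>i\<in>I. (r i + 0) powr \<alpha> i)"
    using \<alpha>_pos r
    by (intro tendsto_prod tendsto_powr' tendsto_add tendsto_const LIMSEQ_Suc[OF lim_1_over_n])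
      (auto intro!: always_eventually)
  then show ?thesis using LIMSEQ_le_const[of _ "\<Prod>i\<in>I. r i powr \<alpha> i" c] * by auto
qed

text \<open>
  These are the minimisers in the arithmetic-geometric mean inequality: up to the factors
  \<open>\<alpha> i\<close>, the gradient of \<open>c * (\<Prod>k\<in>I. u k powr \<alpha> k)\<close>. The inequality is applied to the ratios
  \<open>t i / u i\<close>.
\<close>

lemma geo_dominates_gradient:
  assumes u: "\<And>i. i \<in> I \<Longrightarrow> 0 < u i" and c: "0 \<le> c"
  shows "geo_dominates c (\<lambda>i. ennreal (c * (\<Prod>k\<in>I. u k powr \<alpha> k) / u i))"
  unfolding geo_dominates_def
proof (intro allI impI)
  fix t :: "'i \<Rightarrow> real" assume t: "\<forall>i\<in>I. 0 < t i"
  let ?M = "\<Prod>k\<in>I. u k powr \<alpha> k"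
  have M: "0 \<le> ?M" by (intro prod_nonneg) auto
  have "(\<Prod>i\<in>I. t i powr \<alpha> i) = ?M * (\<Prod>i\<in>I. (t i / u i) powr \<alpha> i)"
    using t u by (subst prod.distrib[symmetric]) (auto simp: powr_divide less_imp_le less_imp_neq[symmetric] intro!: prod.cong)
  also have "\<dots> \<le> ?M * (\<Sum>i\<in>I. \<alpha> i * (t i / u i))"
    using t u M \<alpha>_pos \<alpha>_sum finite_I
    by (intro mult_left_mono weighted_arith_geo_mean) (auto intro: less_imp_le)
  finally have "c * (\<Prod>i\<in>I. t i powr \<alpha> i) \<le> c * (?M * (\<Sum>i\<in>I. \<alpha> i * (t i / u i)))"
    using c by (intro mult_left_mono)
  then have "ennreal (c * (\<Prod>i\<in>I. t i powr \<alpha> i)) \<le> ennreal (\<Sum>i\<in>I. \<alpha> i * t i * (c * ?M / u i))"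
    by (intro ennreal_leI) (simp add: sum_distrib_left mult_ac)
  also have "\<dots> = (\<Sum>i\<in>I. ennreal (\<alpha> i * t i) * ennreal (c * ?M / u i))"
  proof -
    have nn: "0 \<le> \<alpha> i * t i" "0 \<le> c * ?M / u i" if "i \<in> I" for i
      using t c M less_imp_le[OF \<alpha>_pos[OF that]] less_imp_le[OF u[OF that]] that
      by (auto intro!: mult_nonneg_nonneg divide_nonneg_nonneg less_imp_le[of 0 "t i"])
    then have "(\<Sum>i\<in>I. ennreal (\<alpha> i * t i) * ennreal (c * ?M / u i))
        = (\<Sum>i\<in>I. ennreal (\<alpha> i * t i * (c * ?M / u i)))"
      by (intro sum.cong refl ennreal_mult[symmetric])
    also have "\<dots> = ennreal (\<Sum>i\<in>I. \<alpha> i * t i * (c * ?M / u i))"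
      by (rule sum_ennreal) (rule mult_nonneg_nonneg[OF nn])
    finally show ?thesis ..
  qed
  finally show "ennreal (c * (\<Prod>i\<in>I. t i powr \<alpha> i)) \<le> (\<Sum>i\<in>I. ennreal (\<alpha> i * t i) * ennreal (c * ?M / u i))" .
qed

end

section \<open>Positive linear operators\<close>

lemma linear_operatorD:
  assumes "linear_operator Y X T"
  shows "f \<in> simple_functions Y \<Longrightarrow> T f \<in> borel_measurable X"
    and "f \<in> simple_functions Y \<Longrightarrow> g \<in> simple_functions Y \<Longrightarrow>
      AE x in X. T (\<lambda>y. f y + g y) x = T f x + T g x"
    and "f \<in> simple_functions Y \<Longrightarrow> AE x in X. T (\<lambda>y. c * f y) x = c * T f x"
  using assms unfolding linear_operator_def by blast+

lemma linear_operator_combination: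
  assumes T: "linear_operator Y X T" and f: "f \<in> simple_functions Y" and g: "g \<in> simple_functions Y"
  shows "AE x in X. T (\<lambda>y. a * f y + b * g y) x = a * T f x + b * T g x"
proof -
  have "(\<lambda>y. a * f y) \<in> simple_functions Y" "(\<lambda>y. b * g y) \<in> simple_functions Y"
    using f g by (auto intro: simple_functions_compose)
  from linear_operatorD(2)[OF T this] linear_operatorD(3)[OF T f, of a] linear_operatorD(3)[OF T g, of b]
  show ?thesis by eventually_elim simp
qed

lemma positive_operator_nonneg:
  assumes "positive_operator Y X T" "f \<in> simple_functions Y" "\<And>y. y \<in> space Y \<Longrightarrow> 0 \<le> f y"
  shows "AE x in X. 0 \<le> T f x"
  using assms by (auto simp: positive_operator_def)

text \<open>
  Positivity is applied to the nonnegative functions \<open>\<bar>f\<bar> + f\<close> and \<open>\<bar>f\<bar> - f\<close>.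
\<close>

lemma positive_operator_abs_le:
  assumes T: "linear_operator Y X T" "positive_operator Y X T" and f: "f \<in> simple_functions Y"
  shows "AE x in X. \<bar>T f x\<bar> \<le> T (\<lambda>y. \<bar>f y\<bar>) x"
proof -
  have abs: "(\<lambda>y. \<bar>f y\<bar>) \<in> simple_functions Y" using f by (rule simple_functions_compose) simp
  have comb: "AE x in X. 0 \<le> T (\<lambda>y. 1 * \<bar>f y\<bar> + b * f y) x" if "b = 1 \<or> b = -1" for b
  proof (rule positive_operator_nonneg[OF T(2)])
    show "(\<lambda>y. 1 * \<bar>f y\<bar> + b * f y) \<in> simple_functions Y"
      using f by (rule simple_functions_compose) simp
  qed (use that in auto)
  from comb[of 1] comb[of "-1"] linear_operator_combination[OF T(1) abs f, of 1 1]
    linear_operator_combination[OF T(1) abs f, of 1 "-1"]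
  show ?thesis
    by (auto elim!: eventually_elim2 simp: abs_le_iff)
qed

text \<open>
  Saturation as a proof principle: a property that holds wherever any \<open>T h\<close> with \<open>h \<ge> 0\<close> is positive
  holds almost everywhere. Otherwise the exceptional set would contain a set of positive measure on
  which such a \<open>T h\<close> is positive.
\<close>

lemma saturates_AE:
  assumes sat: "saturates Y X T" and P: "{x \<in> space X. \<not> P x} \<in> sets X"
    and pos: "\<And>h. h \<in> simple_functions Y \<Longrightarrow> (\<And>y. y \<in> space Y \<Longrightarrow> 0 \<le> h y) \<Longrightarrow>
      AE x in X. 0 < T h x \<longrightarrow> P x"
  shows "AE x in X. P x"
proof (rule ccontr)
  let ?E = "{x \<in> space X. \<not> P x}"
  assume "\<not> (AE x in X. P x)"
  then have "0 < emeasure X ?E" using AE_iff_measurable[OF P refl] by (auto simp: zero_less_iff_neq_zero)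
  then obtain E' h where E': "E' \<in> sets X" "E' \<subseteq> ?E" "0 < emeasure X E'"
    and h: "h \<in> simple_functions Y" "\<And>y. y \<in> space Y \<Longrightarrow> 0 \<le> h y" "AE x in X. x \<in> E' \<longrightarrow> 0 < T h x"
    using sat P unfolding saturates_def by meson
  have "AE x in X. 0 < T h x \<longrightarrow> P x" using pos[OF h(1)] h(2) by blast
  with h(3) have "AE x in X. x \<notin> E'"
  proof eventually_elim
    case (elim x)
    then show ?case using E'(2) by auto
  qed
  then have "emeasure X E' = 0" using E'(1) by (subst (asm) AE_iff_measurable[of E']) (auto dest: sets.sets_into_space)
  then show False using E'(3) by simp
qed

section \<open>One factorisation for all test functions\<close>

text \<open>
  The setting after Hoelder's inequality: only the bound \<open>K\<close> for integrals against \<open>G\<close> is left of the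
  exponent \<open>q\<close>. The weight \<open>w\<close> is to be positive where \<open>G\<close> is nonzero. Factors matter only where
  \<open>w\<close> is positive, and there the space carries the finite measure with density \<open>w\<close>.
\<close>

locale weighted_positive_operators = convex_weights I \<alpha>
  for I :: "'i set" and \<alpha> :: "'i \<Rightarrow> real" +
  fixes X :: "'a measure" and Y :: "'i \<Rightarrow> 'b measure"
    and T :: "'i \<Rightarrow> ('b \<Rightarrow> real) \<Rightarrow> 'a \<Rightarrow> real" and p :: "'i \<Rightarrow> ennreal"
    and G :: "'a \<Rightarrow> real" and w :: "'a \<Rightarrow> ennreal" and K :: real
  assumes linear: "\<And>i. i \<in> I \<Longrightarrow> linear_operator (Y i) X (T i)"
    and positive: "\<And>i. i \<in> I \<Longrightarrow> positive_operator (Y i) X (T i)"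
    and p: "\<And>i. i \<in> I \<Longrightarrow> 1 \<le> p i"
    and G_meas [measurable]: "G \<in> borel_measurable X" and G_nonneg: "\<And>x. 0 \<le> G x"
    and w_meas [measurable]: "w \<in> borel_measurable X" and w_int: "(\<integral>\<^sup>+x. w x \<partial>X) < \<infinity>"
    and K: "0 \<le> K"
begin

definition unit_ball :: "'i \<Rightarrow> ('b \<Rightarrow> real) set" where
  "unit_ball i = {f \<in> simple_functions (Y i). (\<forall>y\<in>space (Y i). 0 \<le> f y) \<and> Lp_norm (p i) (Y i) f \<le> 1}"

definition unit_balls :: "('i \<Rightarrow> 'b \<Rightarrow> real) set" where
  "unit_balls = {f. \<forall>i\<in>I. f i \<in> unit_ball i}"

definition factors :: "('i \<Rightarrow> 'a \<Rightarrow> ennreal) set" where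
  "factors = {g. (\<forall>i\<in>I. g i \<in> borel_measurable X) \<and>
     (AE x in X. 0 < w x \<longrightarrow> geo_dominates (G x) (\<lambda>i. g i x))}"

text \<open>
  For tests in the unit balls the truncation of negative values by \<open>ennreal\<close> changes the integrand
  on a null set only, because the operators are positive.
\<close>

definition pairing :: "('i \<Rightarrow> 'b \<Rightarrow> real) \<Rightarrow> ('i \<Rightarrow> 'a \<Rightarrow> ennreal) \<Rightarrow> ennreal" where
  "pairing f g =
    (\<integral>\<^sup>+x. (if 0 < w x then \<Sum>i\<in>I. ennreal (\<alpha> i * T i (f i) x) * g i x else 0) \<partial>X)"

lemma T_measurable: "i \<in> I \<Longrightarrow> f \<in> simple_functions (Y i) \<Longrightarrow> T i f \<in> borel_measurable X"
  using linear_operatorD(1)[OF linear] .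

lemma unit_ballD:
  assumes "f \<in> unit_balls" "i \<in> I"
  shows "f i \<in> simple_functions (Y i)" "\<And>y. y \<in> space (Y i) \<Longrightarrow> 0 \<le> f i y"
    "Lp_norm (p i) (Y i) (f i) \<le> 1"
  using assms by (auto simp: unit_balls_def unit_ball_def)

lemma T_unit_ball_measurable:
  "f \<in> unit_balls \<Longrightarrow> i \<in> I \<Longrightarrow> T i (f i) \<in> borel_measurable X"
  by (blast intro: T_measurable unit_ballD(1))

lemma T_unit_balls_nonneg: "f \<in> unit_balls \<Longrightarrow> AE x in X. \<forall>i\<in>I. 0 \<le> T i (f i) x"
  using finite_I
  by (auto simp: AE_finite_all intro!: positive_operator_nonneg[OF positive] intro: unit_ballD)

lemma factors_measurable: "g \<in> factors \<Longrightarrow> i \<in> I \<Longrightarrow> g i \<in> borel_measurable X"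
  by (auto simp: factors_def)

lemma zero_in_unit_ball: "(\<lambda>y. 0) \<in> unit_ball i"
  by (auto simp: unit_ball_def simple_functions_def Lp_norm_zero)

text \<open>
  The pointwise minimiser \<open>G * (\<Prod>k. u k powr \<alpha> k) / u i\<close>, with \<open>u i = T i (f i)\<close>, turns the pairing
  into the integral that is bounded by \<open>K\<close>. Since \<open>u i\<close> may vanish, it is first increased by a
  positive \<open>s x\<close>, which depends measurably on \<open>x\<close> and is so small that the geometric mean times \<open>G x\<close>
  grows by at most \<open>\<eta> * w x\<close>. The total error is then \<open>\<eta>\<close> times the integral of \<open>w\<close>.
\<close>

lemma exists_factor_for_test:
  assumes f: "f \<in> unit_balls"
    and bound: "(\<integral>\<^sup>+x. ennreal (G x * (\<Prod>i\<in>I. T i (f i) x powr \<alpha> i)) \<partial>X) \<le> ennreal K"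
    and e: "0 < e"
  shows "\<exists>g\<in>factors. pairing f g \<le> ennreal (K + e)"
proof -
  note [measurable] = T_unit_ball_measurable[OF f]
  define u where "u i x = max 0 (T i (f i) x)" for i x
  have u_nonneg: "0 \<le> u i x" for i x by (simp add: u_def)
  have [measurable]: "i \<in> I \<Longrightarrow> u i \<in> borel_measurable X" for i
    unfolding u_def by measurable
  obtain W where W: "(\<integral>\<^sup>+x. w x \<partial>X) = ennreal W" "0 \<le> W"
    using w_int by (cases "\<integral>\<^sup>+x. w x \<partial>X") auto
  define \<eta> where "\<eta> = e / (W + 1)"
  have \<eta>: "0 < \<eta>" "\<eta> * W \<le> e"
    using e W by (auto simp: \<eta>_def field_simps mult_left_mono)
  define M where "M s x = (\<Prod>i\<in>I. (u i x + s) powr \<alpha> i)" for s x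
  define Q where "Q n x \<longleftrightarrow> ennreal (G x * M (1 / real (Suc n)) x) \<le> ennreal (G x * M 0 x) + ennreal \<eta> * w x"
    for n x
  define s where "s x = 1 / real (Suc (LEAST n. Q n x))" for x
  have M_meas: "(\<lambda>x. M (h x) x) \<in> borel_measurable X" if [measurable]: "h \<in> borel_measurable X" for h
    unfolding M_def by measurable
  have [measurable]: "Measurable.pred X (Q n)" for n
    unfolding Q_def using M_meas[of "\<lambda>_. 1 / real (Suc n)"] M_meas[of "\<lambda>_. 0"] by measurable
  have s_meas [measurable]: "s \<in> borel_measurable X"
    unfolding s_def by measurable
  have s_pos: "0 < s x" for x by (simp add: s_def)
  have Qs: "ennreal (G x * M (s x) x) \<le> ennreal (G x * M 0 x) + ennreal \<eta> * w x" if "0 < w x" for x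
  proof -
    have "(\<lambda>n. M (1 / real (Suc n)) x) \<longlonglongrightarrow> M 0 x"
      unfolding M_def using less_imp_le[OF \<alpha>_pos] \<alpha>_pos u_nonneg
      by (intro tendsto_prod tendsto_powr' tendsto_add tendsto_const LIMSEQ_Suc[OF lim_1_over_n])
        (auto intro!: always_eventually)
    then have "(\<lambda>n. ennreal (G x * M (1 / real (Suc n)) x)) \<longlonglongrightarrow> ennreal (G x * M 0 x)"
      by (intro tendsto_intros)
    moreover have "ennreal (G x * M 0 x) < ennreal (G x * M 0 x) + ennreal \<eta> * w x"
      using that \<eta> by (auto simp: ennreal_zero_less_mult_iff)
    ultimately have "\<forall>\<^sub>F n in sequentially. ennreal (G x * M (1 / real (Suc n)) x)
        < ennreal (G x * M 0 x) + ennreal \<eta> * w x"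
      by (rule order_tendstoD)
    then have "\<exists>n. Q n x" unfolding Q_def by (auto simp: eventually_sequentially intro: less_imp_le)
    then show ?thesis using LeastI_ex[of "\<lambda>n. Q n x"] by (simp add: Q_def s_def)
  qed
  define g where "g i x = ennreal (G x * M (s x) x / (u i x + s x))" for i x
  have us: "0 < u i x + s x" for i x using u_nonneg s_pos by (intro add_nonneg_pos)
  have M_nonneg: "0 \<le> M r x" for r x unfolding M_def by (intro prod_nonneg) auto
  have "g \<in> factors"
    unfolding factors_def using geo_dominates_gradient[of "\<lambda>i. u i _ + s _" "G _"] us G_nonneg M_meas[OF s_meas]
    by (auto simp: g_def[abs_def] M_def)
  moreover have "pairing f g \<le> ennreal (K + e)"
  proof -
    have "pairing f g \<le> (\<integral>\<^sup>+x. ennreal (G x * (\<Prod>i\<in>I. T i (f i) x powr \<alpha> i)) + ennreal \<eta> * w x \<partial>X)"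
      unfolding pairing_def
    proof (rule nn_integral_mono_AE)
      show "AE x in X. (if 0 < w x then \<Sum>i\<in>I. ennreal (\<alpha> i * T i (f i) x) * g i x else 0)
        \<le> ennreal (G x * (\<Prod>i\<in>I. T i (f i) x powr \<alpha> i)) + ennreal \<eta> * w x"
        using T_unit_balls_nonneg[OF f]
      proof eventually_elim
        case (elim x)
        have Tu: "T i (f i) x = u i x" if "i \<in> I" for i using elim that by (simp add: u_def)
        show ?case
        proof (cases "0 < w x")
          case True
          have "(\<Sum>i\<in>I. ennreal (\<alpha> i * T i (f i) x) * g i x) \<le> (\<Sum>i\<in>I. ennreal (\<alpha> i * (G x * M (s x) x)))"
          proof (rule sum_mono)
            fix i assume i: "i \<in> I"
            have "ennreal (\<alpha> i * T i (f i) x) * g i x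
                = ennreal (\<alpha> i * (G x * M (s x) x) * (u i x / (u i x + s x)))"
              using \<alpha>_pos[OF i] u_nonneg[of i x] us[of i x] G_nonneg[of x] M_nonneg[of "s x" x]
              by (simp add: Tu[OF i] g_def ennreal_mult[symmetric] mult_ac)
            also have "\<dots> \<le> ennreal (\<alpha> i * (G x * M (s x) x) * 1)"
              using \<alpha>_pos[OF i] u_nonneg[of i x] us[of i x] G_nonneg[of x] M_nonneg[of "s x" x] s_pos[of x]
              by (intro ennreal_leI mult_left_mono) auto
            finally show "ennreal (\<alpha> i * T i (f i) x) * g i x \<le> ennreal (\<alpha> i * (G x * M (s x) x))" by simp
          qed
          also have "\<dots> = ennreal (\<Sum>i\<in>I. \<alpha> i * (G x * M (s x) x))"
            using G_nonneg M_nonneg less_imp_le[OF \<alpha>_pos] by (intro sum_ennreal) auto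
          also have "\<dots> = ennreal (G x * M (s x) x)"
            by (simp add: sum_distrib_right[symmetric] \<alpha>_sum)
          also have "\<dots> \<le> ennreal (G x * M 0 x) + ennreal \<eta> * w x" by (rule Qs[OF True])
          also have "M 0 x = (\<Prod>i\<in>I. T i (f i) x powr \<alpha> i)"
            unfolding M_def using Tu by simp
          finally show ?thesis using True by simp
        qed simp
      qed
    qed
    also have "\<dots> = (\<integral>\<^sup>+x. ennreal (G x * (\<Prod>i\<in>I. T i (f i) x powr \<alpha> i)) \<partial>X) + ennreal \<eta> * (\<integral>\<^sup>+x. w x \<partial>X)"
      by (simp add: nn_integral_add nn_integral_cmult)
    also have "\<dots> \<le> ennreal K + ennreal e"
      using bound \<eta> W by (intro add_mono) (auto simp: ennreal_mult[symmetric] intro: ennreal_leI)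
    finally show ?thesis using K e by simp
  qed
  ultimately show ?thesis by blast
qed

lemma factors_convex:
  assumes g: "g \<in> factors" "g' \<in> factors" and l: "0 \<le> l" "l \<le> 1"
  shows "(\<lambda>i x. ennreal l * g i x + ennreal (1 - l) * g' i x) \<in> factors"
proof -
  have "AE x in X. 0 < w x \<longrightarrow> geo_dominates (G x) (\<lambda>i. g i x)"
    "AE x in X. 0 < w x \<longrightarrow> geo_dominates (G x) (\<lambda>i. g' i x)"
    using g by (simp_all add: factors_def)
  then have "AE x in X. 0 < w x \<longrightarrow> geo_dominates (G x) (\<lambda>i. ennreal l * g i x + ennreal (1 - l) * g' i x)"
    by eventually_elim (simp add: geo_dominates_convex l)
  moreover have "(\<lambda>x. ennreal l * g i x + ennreal (1 - l) * g' i x) \<in> borel_measurable X" if "i \<in> I" for i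
    using factors_measurable[OF g(1) that] factors_measurable[OF g(2) that] by measurable
  ultimately show ?thesis by (simp add: factors_def)
qed

lemma pairing_affine_factors:
  assumes f: "f \<in> unit_balls" and g: "g \<in> factors" "g' \<in> factors"
  shows "pairing f (\<lambda>i x. ennreal l * g i x + ennreal m * g' i x)
    = ennreal l * pairing f g + ennreal m * pairing f g'"
proof -
  note [measurable] = T_unit_ball_measurable[OF f] factors_measurable[OF g(1)] factors_measurable[OF g(2)]
  have "ennreal l * pairing f g + ennreal m * pairing f g' = (\<integral>\<^sup>+x.
      ennreal l * (if 0 < w x then \<Sum>i\<in>I. ennreal (\<alpha> i * T i (f i) x) * g i x else 0) +
      ennreal m * (if 0 < w x then \<Sum>i\<in>I. ennreal (\<alpha> i * T i (f i) x) * g' i x else 0) \<partial>X)"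
    unfolding pairing_def by (simp add: nn_integral_add nn_integral_cmult)
  also have "\<dots> = pairing f (\<lambda>i x. ennreal l * g i x + ennreal m * g' i x)"
    unfolding pairing_def
    by (intro nn_integral_cong) (simp add: sum_distrib_left sum.distrib distrib_left mult_ac)
  finally show ?thesis ..
qed

lemma unit_balls_convex:
  assumes f: "f \<in> unit_balls" "f' \<in> unit_balls" and l: "0 \<le> l" "l \<le> 1"
  shows "(\<lambda>i y. l * f i y + (1 - l) * f' i y) \<in> unit_balls"
proof -
  have "(\<lambda>y. l * f i y + (1 - l) * f' i y) \<in> unit_ball i" if i: "i \<in> I" for i
  proof -
    note D = unit_ballD[OF f(1) i] unit_ballD[OF f(2) i]
    have "(\<lambda>y. l * f i y + (1 - l) * f' i y) \<in> simple_functions (Y i)"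
      using D by (intro simple_functions_add simple_functions_compose[where h = "\<lambda>t. _ * t"]) auto
    moreover have "Lp_norm (p i) (Y i) (\<lambda>y. l * f i y + (1 - l) * f' i y) \<le> 1"
      using D l p[OF i] by (intro Lp_unit_ball_convex simple_functions_measurable)
    ultimately show ?thesis using D l by (auto simp: unit_ball_def)
  qed
  then show ?thesis by (simp add: unit_balls_def)
qed

lemma pairing_affine_tests:
  assumes f: "f \<in> unit_balls" "f' \<in> unit_balls" and g: "g \<in> factors" and l: "0 \<le> l" "0 \<le> m"
  shows "pairing (\<lambda>i y. l * f i y + m * f' i y) g = ennreal l * pairing f g + ennreal m * pairing f' g"
proof -
  note [measurable] = T_unit_ball_measurable[OF f(1)] T_unit_ball_measurable[OF f(2)] factors_measurable[OF g]
  have "AE x in X. \<forall>i\<in>I. T i (\<lambda>y. l * f i y + m * f' i y) x = l * T i (f i) x + m * T i (f' i) x"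
    using finite_I linear_operator_combination[OF linear unit_ballD(1)[OF f(1)] unit_ballD(1)[OF f(2)]]
    by (auto simp: AE_finite_all)
  then have "AE x in X. (\<Sum>i\<in>I. ennreal (\<alpha> i * T i (\<lambda>y. l * f i y + m * f' i y) x) * g i x) =
      ennreal l * (\<Sum>i\<in>I. ennreal (\<alpha> i * T i (f i) x) * g i x) +
      ennreal m * (\<Sum>i\<in>I. ennreal (\<alpha> i * T i (f' i) x) * g i x)"
    using T_unit_balls_nonneg[OF f(1)] T_unit_balls_nonneg[OF f(2)]
  proof eventually_elim
    case (elim x)
    have "ennreal (\<alpha> i * T i (\<lambda>y. l * f i y + m * f' i y) x) =
      ennreal l * ennreal (\<alpha> i * T i (f i) x) + ennreal m * ennreal (\<alpha> i * T i (f' i) x)" if "i \<in> I" for i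
    proof -
      have "ennreal l * ennreal (\<alpha> i * T i (f i) x) + ennreal m * ennreal (\<alpha> i * T i (f' i) x)
          = ennreal (l * (\<alpha> i * T i (f i) x) + m * (\<alpha> i * T i (f' i) x))"
        using elim that l less_imp_le[OF \<alpha>_pos[OF that]]
        by (simp add: ennreal_mult[symmetric] ennreal_plus[symmetric] del: ennreal_plus)
      then show ?thesis using elim that by (simp add: distrib_left mult_ac)
    qed
    then show ?case
      by (simp add: sum_distrib_left sum.distrib[symmetric] distrib_left distrib_right mult_ac)
  qed
  then have "pairing (\<lambda>i y. l * f i y + m * f' i y) g = (\<integral>\<^sup>+x.
      ennreal l * (if 0 < w x then \<Sum>i\<in>I. ennreal (\<alpha> i * T i (f i) x) * g i x else 0) +
      ennreal m * (if 0 < w x then \<Sum>i\<in>I. ennreal (\<alpha> i * T i (f' i) x) * g i x else 0) \<partial>X)"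
    unfolding pairing_def
    by (intro nn_integral_cong_AE) (auto elim!: eventually_mono split: if_split)
  also have "\<dots> = ennreal l * pairing f g + ennreal m * pairing f' g"
    unfolding pairing_def by (simp add: nn_integral_add nn_integral_cmult)
  finally show ?thesis .
qed

lemma factors_closed:
  assumes u: "\<And>n. u n \<in> factors" and g: "\<And>i. i \<in> I \<Longrightarrow> g i \<in> borel_measurable X"
    and lim: "AE x in X. 0 < w x \<longrightarrow> (\<forall>i\<in>I. (\<lambda>n. u n i x) \<longlonglongrightarrow> g i x)"
  shows "g \<in> factors"
proof -
  have "AE x in X. \<forall>n. 0 < w x \<longrightarrow> geo_dominates (G x) (\<lambda>i. u n i x)"
    unfolding AE_all_countable using u by (simp add: factors_def)
  then have "AE x in X. 0 < w x \<longrightarrow> geo_dominates (G x) (\<lambda>i. g i x)"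
    using lim
  proof eventually_elim
    case (elim x)
    show ?case
      by (rule impI, rule geo_dominates_limit[where u = "\<lambda>n i. u n i x"]) (use elim in auto)
  qed
  then show ?thesis using g by (simp add: factors_def)
qed

text \<open>
  Fatou's lemma: the integrand is linear in \<open>g\<close> with finite nonnegative coefficients, hence continuous
  even at infinite values.
\<close>

lemma pairing_lower_semicontinuous:
  assumes f: "f \<in> unit_balls" and u: "\<And>n. u n \<in> factors" and g: "g \<in> factors"
    and lim: "AE x in X. 0 < w x \<longrightarrow> (\<forall>i\<in>I. (\<lambda>n. u n i x) \<longlonglongrightarrow> g i x)"
    and le: "\<And>n. pairing f (u n) \<le> c"
  shows "pairing f g \<le> c"
proof -
  note [measurable] = T_unit_ball_measurable[OF f] factors_measurable[OF g] factors_measurable[OF u]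
  let ?h = "\<lambda>g x. (if 0 < w x then \<Sum>i\<in>I. ennreal (\<alpha> i * T i (f i) x) * g i x else 0)"
  have "AE x in X. ?h g x = liminf (\<lambda>n. ?h (u n) x)"
    using lim
  proof eventually_elim
    case (elim x)
    have "(\<lambda>n. ?h (u n) x) \<longlonglongrightarrow> ?h g x"
    proof (cases "0 < w x")
      case True
      then have "(\<lambda>n. \<Sum>i\<in>I. ennreal (\<alpha> i * T i (f i) x) * u n i x) \<longlonglongrightarrow>
          (\<Sum>i\<in>I. ennreal (\<alpha> i * T i (f i) x) * g i x)"
        using elim by (intro tendsto_sum ennreal_tendsto_cmult) auto
      then show ?thesis using True by simp
    qed simp
    then show ?case by (simp add: lim_imp_Liminf)
  qed
  then have "pairing f g = (\<integral>\<^sup>+x. liminf (\<lambda>n. ?h (u n) x) \<partial>X)"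
    unfolding pairing_def by (rule nn_integral_cong_AE)
  also have "\<dots> \<le> liminf (\<lambda>n. \<integral>\<^sup>+x. ?h (u n) x \<partial>X)" by (rule nn_integral_liminf) measurable
  also have "\<dots> \<le> c"
  proof -
    have "liminf (\<lambda>n. \<integral>\<^sup>+x. ?h (u n) x \<partial>X) \<le> liminf (\<lambda>n. c)"
      using le by (intro Liminf_mono always_eventually) (auto simp: pairing_def)
    then show ?thesis by (simp add: Liminf_const)
  qed
  finally show ?thesis .
qed

text \<open>
  Convex compactness is applied to the sets of factors that are good for one test up to the error
  \<open>1 / Suc n\<close>. Finitely many of these sets meet by the finite minimax inequality, applied with the
  smallest of the errors.
\<close>

lemma exists_uniform_factor:
  assumes bound: "\<And>f. f \<in> unit_balls \<Longrightarrow>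
      (\<integral>\<^sup>+x. ennreal (G x * (\<Prod>i\<in>I. T i (f i) x powr \<alpha> i)) \<partial>X) \<le> ennreal K"
  obtains g where "g \<in> factors" "\<And>f. f \<in> unit_balls \<Longrightarrow> pairing f g \<le> ennreal K"
proof -
  have zero: "(\<lambda>_ _. 0) \<in> unit_balls" by (simp add: unit_balls_def zero_in_unit_ball)
  have ne: "factors \<noteq> {}" using exists_factor_for_test[OF zero bound[OF zero], of 1] by auto
  have finite_tests: "\<exists>g\<in>factors. \<forall>f\<in>F. pairing f g \<le> ennreal (K + e)"
    if "finite F" "F \<subseteq> unit_balls" "0 < e" for F e
  proof (rule finite_minimax[OF that(1,2) ne _ _ _ K that(3)])
    show "\<exists>g''\<in>factors. \<forall>f\<in>unit_balls. pairing f g'' \<le> ennreal l * pairing f g + ennreal (1 - l) * pairing f g'"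
      if "g \<in> factors" "g' \<in> factors" "0 \<le> l" "l \<le> 1" for g g' l
      by (rule bexI[OF _ factors_convex[OF that]]) (auto simp: pairing_affine_factors that)
    show "\<exists>f''\<in>unit_balls. \<forall>g\<in>factors. ennreal l * pairing f g + ennreal (1 - l) * pairing f' g \<le> pairing f'' g"
      if "f \<in> unit_balls" "f' \<in> unit_balls" "0 \<le> l" "l \<le> 1" for f f' l
      by (rule bexI[OF _ unit_balls_convex[OF that]]) (auto simp: pairing_affine_tests that)
  qed (rule exists_factor_for_test[OF _ bound])
  define S where "S = (\<lambda>(f, n). {g \<in> factors. pairing f g \<le> ennreal (K + 1 / real (Suc n))})"
  have S: "g \<in> S (f, n) \<longleftrightarrow> g \<in> factors \<and> pairing f g \<le> ennreal (K + 1 / real (Suc n))" for f n g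
    by (simp add: S_def)
  interpret N: finite_measure "density X w"
    by (rule finite_measureI) (use w_int in \<open>simp add: emeasure_density cong: nn_integral_cong\<close>)
  have "\<Inter>(S ` (unit_balls \<times> UNIV)) \<noteq> {}"
  proof (rule N.convex_compactness[OF finite_I])
    fix R g g' assume "R \<in> S ` (unit_balls \<times> UNIV)" and g: "g \<in> R" "g' \<in> R"
    then obtain f n where f: "f \<in> unit_balls" and R: "R = S (f, n)" by auto
    let ?h = "\<lambda>i x. ennreal (1/2) * g i x + ennreal (1/2) * g' i x"
    have g: "g \<in> factors" "pairing f g \<le> ennreal (K + 1 / real (Suc n))"
      "g' \<in> factors" "pairing f g' \<le> ennreal (K + 1 / real (Suc n))"
      using g by (auto simp: R S)
    have "pairing f ?h = ennreal (1/2) * pairing f g + ennreal (1/2) * pairing f g'"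
      by (rule pairing_affine_factors[OF f g(1,3)])
    also have "\<dots> \<le> ennreal (1/2) * ennreal (K + 1 / real (Suc n)) + ennreal (1/2) * ennreal (K + 1 / real (Suc n))"
      using g by (intro add_mono mult_left_mono) auto
    also have "\<dots> = ennreal (K + 1 / real (Suc n))"
      using K by (simp only: ennreal_mult[symmetric] ennreal_plus[symmetric] mult_nonneg_nonneg
          add_nonneg_nonneg divide_nonneg_nonneg of_nat_0_le_iff zero_le_one) simp
    finally show "?h \<in> R" using factors_convex[OF g(1,3), of "1/2"] by (simp add: R S)
  next
    fix R u g assume "R \<in> S ` (unit_balls \<times> UNIV)" and u: "\<And>n. u n \<in> R"
      and g: "\<And>i. i \<in> I \<Longrightarrow> g i \<in> borel_measurable (density X w)"
      and "AE x in density X w. \<forall>i\<in>I. (\<lambda>n. u n i x) \<longlonglongrightarrow> g i x"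
    then obtain f n where f: "f \<in> unit_balls" and R: "R = S (f, n)"
      and lim: "AE x in X. 0 < w x \<longrightarrow> (\<forall>i\<in>I. (\<lambda>n. u n i x) \<longlonglongrightarrow> g i x)"
      by (auto simp: AE_density)
    have u: "u m \<in> factors" "pairing f (u m) \<le> ennreal (K + 1 / real (Suc n))" for m
      using u by (auto simp: R S)
    have "g \<in> factors" using g by (intro factors_closed[OF u(1) _ lim]) simp
    with pairing_lower_semicontinuous[OF f u(1) this lim u(2)] show "g \<in> R" by (simp add: R S)
  next
    fix F assume "finite F" "F \<subseteq> S ` (unit_balls \<times> UNIV)"
    then obtain A where A: "A \<subseteq> unit_balls \<times> UNIV" "finite A" "F = S ` A"
      by (meson finite_subset_image)
    define m where "m = Max (insert 0 (snd ` A))"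
    have m: "n \<le> m" if "(f, n) \<in> A" for f n
      unfolding m_def using A that by (intro Max_ge) force+
    have "\<exists>g\<in>factors. \<forall>f\<in>fst ` A. pairing f g \<le> ennreal (K + 1 / real (Suc m))"
      using A by (intro finite_tests) auto
    then obtain g where g: "g \<in> factors"
      "\<And>f. f \<in> fst ` A \<Longrightarrow> pairing f g \<le> ennreal (K + 1 / real (Suc m))"
      by blast
    have "g \<in> S (f, n)" if "(f, n) \<in> A" for f n
    proof -
      have "pairing f g \<le> ennreal (K + 1 / real (Suc m))" using that by (intro g(2)) force
      also have "\<dots> \<le> ennreal (K + 1 / real (Suc n))"
        using m[OF that] by (intro ennreal_leI add_left_mono divide_left_mono) auto
      finally show ?thesis using g(1) by (simp add: S)
    qed
    then have "g \<in> \<Inter>F" unfolding A(3) by fast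
    then show "\<Inter>F \<noteq> {}" by blast
  qed (auto simp: S_def factors_def)
  then obtain g where g: "\<And>f n. f \<in> unit_balls \<Longrightarrow> g \<in> S (f, n)" by auto
  have "g \<in> factors" using g[OF zero] by (simp add: S)
  moreover have "pairing f g \<le> ennreal K" if "f \<in> unit_balls" for f
  proof (rule LIMSEQ_le_const)
    have "(\<lambda>n. K + 1 / real (Suc n)) \<longlonglongrightarrow> K + 0"
      by (intro tendsto_add tendsto_const LIMSEQ_Suc[OF lim_1_over_n])
    then show "(\<lambda>n. ennreal (K + 1 / real (Suc n))) \<longlonglongrightarrow> ennreal K"
      by (intro tendsto_ennrealI) simp
    show "\<exists>n0. \<forall>n\<ge>n0. pairing f g \<le> ennreal (K + 1 / real (Suc n))"
      using g[OF that] by (auto simp: S)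
  qed
  ultimately show ?thesis by (rule that)
qed

end

context weighted_positive_operators
begin

section \<open>Rescaling the factors\<close>

definition test_integral :: "'i \<Rightarrow> ('b \<Rightarrow> real) \<Rightarrow> ('a \<Rightarrow> ennreal) \<Rightarrow> ennreal" where
  "test_integral i h \<gamma> = (\<integral>\<^sup>+x. (if 0 < w x then ennreal (T i h x) * \<gamma> x else 0) \<partial>X)"

definition dual_norm :: "'i \<Rightarrow> ('a \<Rightarrow> ennreal) \<Rightarrow> ennreal" where
  "dual_norm i \<gamma> = (SUP h\<in>unit_ball i. test_integral i h \<gamma>)"

lemma pairing_eq_sum_test_integral:
  assumes f: "f \<in> unit_balls" and g: "g \<in> factors"
  shows "pairing f g = (\<Sum>i\<in>I. ennreal (\<alpha> i) * test_integral i (f i) (g i))"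
proof -
  note [measurable] = T_unit_ball_measurable[OF f] factors_measurable[OF g]
  have "(\<Sum>i\<in>I. ennreal (\<alpha> i) * test_integral i (f i) (g i))
      = (\<Sum>i\<in>I. \<integral>\<^sup>+x. ennreal (\<alpha> i) * (if 0 < w x then ennreal (T i (f i) x) * g i x else 0) \<partial>X)"
    unfolding test_integral_def by (intro sum.cong refl nn_integral_cmult[symmetric]) measurable
  also have "\<dots> = (\<integral>\<^sup>+x. (\<Sum>i\<in>I. ennreal (\<alpha> i) * (if 0 < w x then ennreal (T i (f i) x) * g i x else 0)) \<partial>X)"
    by (intro nn_integral_sum[symmetric]) measurable
  also have "\<dots> = pairing f g"
    unfolding pairing_def
    by (intro nn_integral_cong)
      (auto simp: ennreal_mult' less_imp_le[OF \<alpha>_pos] mult_ac intro!: sum.cong)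
  finally show ?thesis ..
qed

text \<open>
  The tests for different indices are chosen independently, so a sum of suprema is a supremum of
  sums. Finiteness of each supremum comes first, by testing with \<open>0\<close> at all other indices; it makes
  approximation of the suprema possible.
\<close>

lemma dual_norm_sum_le:
  assumes g: "g \<in> factors" and le: "\<And>f. f \<in> unit_balls \<Longrightarrow> pairing f g \<le> ennreal K"
  shows "(\<Sum>i\<in>I. ennreal (\<alpha> i) * dual_norm i (g i)) \<le> ennreal K"
    and "\<And>i. i \<in> I \<Longrightarrow> dual_norm i (g i) < \<infinity>"
proof -
  show fin: "dual_norm i (g i) < \<infinity>" if i: "i \<in> I" for i
  proof -
    have "test_integral i h (g i) \<le> ennreal (K / \<alpha> i)" if h: "h \<in> unit_ball i" for h
    proof -
      define f where "f = (\<lambda>k. if k = i then h else (\<lambda>y. 0))"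
      have f: "f \<in> unit_balls" using h zero_in_unit_ball by (auto simp: f_def unit_balls_def)
      have "ennreal (\<alpha> i) * test_integral i (f i) (g i) \<le> (\<Sum>i\<in>I. ennreal (\<alpha> i) * test_integral i (f i) (g i))"
        using finite_I i by (intro member_le_sum) auto
      also have "\<dots> \<le> ennreal K" using le[OF f] by (simp add: pairing_eq_sum_test_integral[OF f g])
      finally have "ennreal (1 / \<alpha> i) * (ennreal (\<alpha> i) * test_integral i h (g i)) \<le> ennreal (1 / \<alpha> i) * ennreal K"
        by (intro mult_left_mono) (auto simp: f_def)
      then show ?thesis using \<alpha>_pos[OF i] K
        by (simp add: mult.assoc[symmetric] ennreal_mult[symmetric])
    qed
    then have "dual_norm i (g i) \<le> ennreal (K / \<alpha> i)" unfolding dual_norm_def by (intro SUP_least)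
    then show ?thesis by (auto simp: less_top[symmetric] top_unique)
  qed
  show "(\<Sum>i\<in>I. ennreal (\<alpha> i) * dual_norm i (g i)) \<le> ennreal K"
  proof (rule ennreal_le_epsilon)
    fix e :: real assume e: "0 < e"
    have "\<exists>h\<in>unit_ball i. dual_norm i (g i) < test_integral i h (g i) + ennreal e" if "i \<in> I" for i
      using e fin[OF that] zero_in_unit_ball[of i]
      by (intro SUP_approx_ennreal[OF _ _ dual_norm_def]) auto
    then obtain f where f: "\<And>i. i \<in> I \<Longrightarrow> f i \<in> unit_ball i"
      "\<And>i. i \<in> I \<Longrightarrow> dual_norm i (g i) < test_integral i (f i) (g i) + ennreal e"
      by metis
    have f': "f \<in> unit_balls" using f by (simp add: unit_balls_def)
    have "(\<Sum>i\<in>I. ennreal (\<alpha> i) * dual_norm i (g i))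
        \<le> (\<Sum>i\<in>I. ennreal (\<alpha> i) * (test_integral i (f i) (g i) + ennreal e))"
      using f(2) by (intro sum_mono mult_left_mono) (auto intro: less_imp_le)
    also have "\<dots> = pairing f g + (\<Sum>i\<in>I. ennreal (\<alpha> i)) * ennreal e"
      by (simp add: pairing_eq_sum_test_integral[OF f' g] distrib_left sum.distrib sum_distrib_right)
    also have "(\<Sum>i\<in>I. ennreal (\<alpha> i)) = 1"
      using less_imp_le[OF \<alpha>_pos] by (subst sum_ennreal) (auto simp: \<alpha>_sum)
    finally show "(\<Sum>i\<in>I. ennreal (\<alpha> i) * dual_norm i (g i)) \<le> ennreal K + ennreal e"
      using le[OF f'] by (auto intro: order_trans add_right_mono)
  qed
qed

text \<open>
  Homogeneity. An upper bound \<open>r > 0\<close> for the norm takes the place of the norm itself, so that functions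
  \<open>h\<close> of norm \<open>0\<close> are included.
\<close>

lemma test_integral_le_dual_norm:
  assumes i: "i \<in> I" and h: "h \<in> simple_functions (Y i)" "\<And>y. y \<in> space (Y i) \<Longrightarrow> 0 \<le> h y"
    and r: "0 < r" "Lp_norm (p i) (Y i) h \<le> ennreal r"
    and \<gamma>[measurable]: "\<gamma> \<in> borel_measurable X"
  shows "test_integral i h \<gamma> \<le> ennreal r * dual_norm i \<gamma>"
proof -
  let ?h = "\<lambda>y. (1 / r) * h y"
  have h': "?h \<in> unit_ball i"
    using h r p[OF i] Lp_norm_divide_le_1[OF p[OF i] simple_functions_measurable[OF h(1)] r]
      simple_functions_compose[OF h(1), of "\<lambda>t. (1 / r) * t"]
    by (auto simp: unit_ball_def)
  then have [measurable]: "T i ?h \<in> borel_measurable X"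
    using T_measurable[OF i] by (auto simp: unit_ball_def)
  have "AE x in X. T i h x = r * T i ?h x"
    using linear_operatorD(3)[OF linear[OF i] h(1), of "1 / r"] by eventually_elim (use r in simp)
  then have "test_integral i h \<gamma> = (\<integral>\<^sup>+x. ennreal r * (if 0 < w x then ennreal (T i ?h x) * \<gamma> x else 0) \<partial>X)"
    unfolding test_integral_def using r
    by (intro nn_integral_cong_AE) (auto elim!: eventually_mono simp: ennreal_mult' mult_ac)
  also have "\<dots> = ennreal r * test_integral i ?h \<gamma>"
    unfolding test_integral_def by (intro nn_integral_cmult) measurable
  also have "\<dots> \<le> ennreal r * dual_norm i \<gamma>"
    unfolding dual_norm_def using h' by (intro mult_left_mono SUP_upper) auto
  finally show ?thesis .
qed

text \<open>
  If \<open>\<gamma>\<close> were infinite where \<open>T i h\<close> is positive, on a set of positive measure, its integral against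
  \<open>T i h\<close> would be infinite.
\<close>

lemma factor_finite:
  assumes i: "i \<in> I" and sat: "saturates (Y i) X (T i)" and \<gamma>[measurable]: "\<gamma> \<in> borel_measurable X"
    and fin: "dual_norm i \<gamma> < \<infinity>"
  shows "AE x in X. 0 < w x \<longrightarrow> \<gamma> x \<noteq> \<infinity>"
proof (rule saturates_AE[OF sat])
  fix h assume h: "h \<in> simple_functions (Y i)" "\<And>y. y \<in> space (Y i) \<Longrightarrow> 0 \<le> h y"
  have [measurable]: "T i h \<in> borel_measurable X" using i h by (intro T_measurable)
  obtain r where r: "0 \<le> r" "Lp_norm (p i) (Y i) h = ennreal r"
    using Lp_norm_simple_function_finite[OF p[OF i] h(1)] by (cases "Lp_norm (p i) (Y i) h") auto
  have "test_integral i h \<gamma> \<le> ennreal (r + 1) * dual_norm i \<gamma>"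
    using r by (intro test_integral_le_dual_norm i h \<gamma>) (auto intro: ennreal_leI simp del: ennreal_plus)
  also have "\<dots> < \<infinity>" using fin by (simp add: ennreal_mult_less_top)
  finally have "AE x in X. (if 0 < w x then ennreal (T i h x) * \<gamma> x else 0) \<noteq> \<infinity>"
    unfolding test_integral_def by (intro nn_integral_noteq_infinite) auto
  then show "AE x in X. 0 < T i h x \<longrightarrow> 0 < w x \<longrightarrow> \<gamma> x \<noteq> \<infinity>"
    by eventually_elim (auto simp: ennreal_mult_top)
qed measurable

lemma factor_zero:
  assumes i: "i \<in> I" and sat: "saturates (Y i) X (T i)" and \<gamma>[measurable]: "\<gamma> \<in> borel_measurable X"
    and zero: "dual_norm i \<gamma> = 0"
  shows "AE x in X. 0 < w x \<longrightarrow> \<gamma> x = 0"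
proof (rule saturates_AE[OF sat])
  fix h assume h: "h \<in> simple_functions (Y i)" "\<And>y. y \<in> space (Y i) \<Longrightarrow> 0 \<le> h y"
  have [measurable]: "T i h \<in> borel_measurable X" using i h by (intro T_measurable)
  obtain r where r: "0 \<le> r" "Lp_norm (p i) (Y i) h = ennreal r"
    using Lp_norm_simple_function_finite[OF p[OF i] h(1)] by (cases "Lp_norm (p i) (Y i) h") auto
  have "test_integral i h \<gamma> \<le> ennreal (r + 1) * dual_norm i \<gamma>"
    using r by (intro test_integral_le_dual_norm i h \<gamma>) (auto intro: ennreal_leI simp del: ennreal_plus)
  then have "test_integral i h \<gamma> = 0" using zero by simp
  then have "AE x in X. (if 0 < w x then ennreal (T i h x) * \<gamma> x else 0) = 0"
    unfolding test_integral_def by (subst (asm) nn_integral_0_iff_AE) auto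
  then show "AE x in X. 0 < T i h x \<longrightarrow> 0 < w x \<longrightarrow> \<gamma> x = 0"
    by eventually_elim auto
qed measurable

text \<open>
  The factors are rescaled by \<open>K / n i\<close>, where \<open>n i\<close> is the dual norm. This preserves domination
  because the arithmetic-geometric mean inequality bounds the weighted geometric mean of the \<open>n i\<close> by
  their weighted arithmetic mean, hence by \<open>K\<close>.
\<close>

theorem factorisation:
  assumes sat: "\<And>i. i \<in> I \<Longrightarrow> saturates (Y i) X (T i)"
    and supp: "AE x in X. G x \<noteq> 0 \<longrightarrow> 0 < w x"
    and bound: "\<And>f. f \<in> unit_balls \<Longrightarrow>
      (\<integral>\<^sup>+x. ennreal (G x * (\<Prod>i\<in>I. T i (f i) x powr \<alpha> i)) \<partial>X) \<le> ennreal K"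
  obtains g :: "'i \<Rightarrow> 'a \<Rightarrow> real" where
    "\<And>i. i \<in> I \<Longrightarrow> g i \<in> borel_measurable X" "\<And>i x. 0 \<le> g i x"
    "AE x in X. G x \<le> (\<Prod>i\<in>I. g i x powr \<alpha> i)"
    "\<And>i h. i \<in> I \<Longrightarrow> h \<in> simple_functions (Y i) \<Longrightarrow> (\<And>y. y \<in> space (Y i) \<Longrightarrow> 0 \<le> h y) \<Longrightarrow>
      (\<integral>\<^sup>+x. ennreal (g i x * T i h x) \<partial>X) \<le> ennreal K * Lp_norm (p i) (Y i) h"
proof (cases "AE x in X. G x = 0")
  case True
  then have "AE x in X. G x \<le> (\<Prod>i\<in>I. (\<lambda>i x. 0 :: real) i x powr \<alpha> i)"
    by (auto elim!: eventually_mono intro!: prod_nonneg)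
  then show ?thesis by (intro that[of "\<lambda>i x. 0"]) auto
next
  case False
  obtain \<gamma> where \<gamma>: "\<gamma> \<in> factors" and le: "\<And>f. f \<in> unit_balls \<Longrightarrow> pairing f \<gamma> \<le> ennreal K"
    using exists_uniform_factor[OF bound] by blast
  note \<gamma>_meas [measurable] = factors_measurable[OF \<gamma>]
  have dual_sum: "(\<Sum>i\<in>I. ennreal (\<alpha> i) * dual_norm i (\<gamma> i)) \<le> ennreal K"
    by (rule dual_norm_sum_le(1)[OF \<gamma>]) (rule le)
  have dual_fin: "dual_norm i (\<gamma> i) < \<infinity>" if "i \<in> I" for i
    by (rule dual_norm_sum_le(2)[OF \<gamma> _ that]) (rule le)
  have fin: "AE x in X. \<forall>i\<in>I. 0 < w x \<longrightarrow> \<gamma> i x \<noteq> \<infinity>"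
    unfolding AE_finite_all[OF finite_I]
  proof
    fix i assume i: "i \<in> I"
    show "AE x in X. 0 < w x \<longrightarrow> \<gamma> i x \<noteq> \<infinity>"
      by (rule factor_finite[OF i sat[OF i] \<gamma>_meas[OF i] dual_fin[OF i]])
  qed
  have dom: "AE x in X. 0 < w x \<longrightarrow> G x \<le> (\<Prod>i\<in>I. enn2real (\<gamma> i x) powr \<alpha> i)"
  proof -
    have "AE x in X. 0 < w x \<longrightarrow> geo_dominates (G x) (\<lambda>i. \<gamma> i x)"
      using \<gamma> by (simp add: factors_def)
    then show ?thesis using fin
    proof eventually_elim
      case (elim x)
      show ?case
      proof
        assume w: "0 < w x"
        have "geo_dominates (G x) (\<lambda>i. ennreal (enn2real (\<gamma> i x)))"
          using elim w by (auto simp: geo_dominates_def less_top)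
        then show "G x \<le> (\<Prod>i\<in>I. enn2real (\<gamma> i x) powr \<alpha> i)"
          by (rule geo_dominates_real) (auto simp: G_nonneg)
      qed
    qed
  qed
  define n where "n i = enn2real (dual_norm i (\<gamma> i))" for i
  have n: "dual_norm i (\<gamma> i) = ennreal (n i)" if "i \<in> I" for i
    using dual_fin[OF that] by (simp add: n_def)
  (* A vanishing dual norm would make one factor, hence the product and G, vanish. *)
  have n_pos: "0 < n i" if i: "i \<in> I" for i
  proof (rule ccontr)
    assume "\<not> 0 < n i"
    then have "dual_norm i (\<gamma> i) = 0" unfolding n[OF i] by (simp add: ennreal_eq_0_iff)
    then have "AE x in X. 0 < w x \<longrightarrow> \<gamma> i x = 0"
      by (rule factor_zero[OF i sat[OF i] \<gamma>_meas[OF i]])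
    with dom supp have "AE x in X. G x = 0"
    proof eventually_elim
      case (elim x)
      show ?case
      proof (rule ccontr)
        assume "G x \<noteq> 0"
        then have "G x \<le> (\<Prod>i\<in>I. enn2real (\<gamma> i x) powr \<alpha> i)" "\<gamma> i x = 0" using elim by auto
        moreover from this(2) have "(\<Prod>i\<in>I. enn2real (\<gamma> i x) powr \<alpha> i) = 0"
          using finite_I i by (auto intro!: prod_zero bexI[of _ i])
        ultimately show False using G_nonneg[of x] \<open>G x \<noteq> 0\<close> by simp
      qed
    qed
    then show False using False by simp
  qed
  have sum_le: "(\<Sum>i\<in>I. \<alpha> i * n i) \<le> K"
  proof -
    have "(\<Sum>i\<in>I. ennreal (\<alpha> i) * dual_norm i (\<gamma> i)) = (\<Sum>i\<in>I. ennreal (\<alpha> i * n i))"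
      using n less_imp_le[OF \<alpha>_pos] less_imp_le[OF n_pos] by (intro sum.cong) (auto simp: ennreal_mult)
    also have "\<dots> = ennreal (\<Sum>i\<in>I. \<alpha> i * n i)"
      using \<alpha>_pos n_pos by (intro sum_ennreal) (auto intro: less_imp_le)
    finally show ?thesis using dual_sum K by simp
  qed
  have prod_le: "(\<Prod>i\<in>I. n i powr \<alpha> i) \<le> K"
    using weighted_arith_geo_mean[OF finite_I \<alpha>_pos \<alpha>_sum, of n] n_pos sum_le by (force intro: less_imp_le)
  have prod_pos: "0 < (\<Prod>i\<in>I. n i powr \<alpha> i)" using n_pos by (intro prod_pos) force
  then have K_pos: "0 < K" using prod_le by simp
  have scale: "1 \<le> (\<Prod>i\<in>I. (K / n i) powr \<alpha> i)"
  proof -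
    have "(\<Prod>i\<in>I. (K / n i) powr \<alpha> i) = (\<Prod>i\<in>I. K powr \<alpha> i) / (\<Prod>i\<in>I. n i powr \<alpha> i)"
      using K_pos n_pos by (subst prod_dividef[symmetric]) (auto simp: powr_divide less_imp_le intro!: prod.cong)
    also have "(\<Prod>i\<in>I. K powr \<alpha> i) = K"
      using K_pos finite_I by (simp add: powr_sum[symmetric] \<alpha>_sum)
    finally show ?thesis using prod_le prod_pos by simp
  qed
  (* The factors are set to 0 where w vanishes: nothing is known about them there, and G vanishes
     too. *)
  define g where "g i x = (if 0 < w x then K / n i * enn2real (\<gamma> i x) else 0)" for i x
  show ?thesis
  proof (rule that[of "\<lambda>i x. if i \<in> I then g i x else 0"])
    fix i show "i \<in> I \<Longrightarrow> (\<lambda>x. if i \<in> I then g i x else 0) \<in> borel_measurable X"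
      unfolding g_def by measurable
  next
    fix i x show "0 \<le> (if i \<in> I then g i x else 0)" using n_pos[of i] K_pos by (auto simp: g_def)
  next
    show "AE x in X. G x \<le> (\<Prod>i\<in>I. (if i \<in> I then g i x else 0) powr \<alpha> i)"
      using dom supp
    proof eventually_elim
      case (elim x)
      show ?case
      proof (cases "0 < w x")
        case True
        have "G x \<le> 1 * (\<Prod>i\<in>I. enn2real (\<gamma> i x) powr \<alpha> i)" using elim True by simp
        also have "\<dots> \<le> (\<Prod>i\<in>I. (K / n i) powr \<alpha> i) * (\<Prod>i\<in>I. enn2real (\<gamma> i x) powr \<alpha> i)"
          using scale by (intro mult_right_mono prod_nonneg) auto
        also have "\<dots> = (\<Prod>i\<in>I. (if i \<in> I then g i x else 0) powr \<alpha> i)"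
          using True K_pos n_pos by (subst prod.distrib[symmetric])
            (auto simp: g_def powr_mult less_imp_le simp del: times_divide_eq_left intro!: prod.cong)
        finally show ?thesis .
      next
        case False
        then have "G x = 0" using elim by auto
        then show ?thesis by (auto intro: prod_nonneg)
      qed
    qed
  next
    fix i h assume i: "i \<in> I" and h: "h \<in> simple_functions (Y i)" "\<And>y. y \<in> space (Y i) \<Longrightarrow> 0 \<le> h y"
    have [measurable]: "T i h \<in> borel_measurable X" using i h by (intro T_measurable)
    note [measurable] = \<gamma>_meas[OF i]
    obtain r where r: "0 \<le> r" "Lp_norm (p i) (Y i) h = ennreal r"
      using Lp_norm_simple_function_finite[OF p[OF i] h(1)] by (cases "Lp_norm (p i) (Y i) h") auto
    have "(\<integral>\<^sup>+x. ennreal (g i x * T i h x) \<partial>X)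
        = (\<integral>\<^sup>+x. ennreal (K / n i) * (if 0 < w x then ennreal (T i h x) * \<gamma> i x else 0) \<partial>X)"
    proof (rule nn_integral_cong_AE)
      show "AE x in X. ennreal (g i x * T i h x)
          = ennreal (K / n i) * (if 0 < w x then ennreal (T i h x) * \<gamma> i x else 0)"
        using fin
      proof eventually_elim
        case (elim x)
        show ?case
        proof (cases "0 < w x")
          case True
          then obtain s where "\<gamma> i x = ennreal s" "0 \<le> s" using elim i by (cases "\<gamma> i x") auto
          moreover have "0 \<le> K / n i" using K_pos n_pos[OF i] by simp
          ultimately show ?thesis using True
            by (simp add: g_def ennreal_mult' mult_ac del: times_divide_eq_left times_divide_eq_right)
        qed (simp add: g_def)
      qed
    qed
    also have "\<dots> = ennreal (K / n i) * test_integral i h (\<gamma> i)"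
      unfolding test_integral_def by (intro nn_integral_cmult) measurable
    also have "\<dots> \<le> ennreal (K * r)"
    proof (rule LIMSEQ_le_const)
      have "(\<lambda>m. K * (r + 1 / real (Suc m))) \<longlonglongrightarrow> K * (r + 0)"
        by (intro tendsto_mult tendsto_add tendsto_const LIMSEQ_Suc[OF lim_1_over_n])
      then show "(\<lambda>m. ennreal (K * (r + 1 / real (Suc m)))) \<longlonglongrightarrow> ennreal (K * r)"
        by (intro tendsto_ennrealI) simp
      have "ennreal (K / n i) * test_integral i h (\<gamma> i) \<le> ennreal (K * s)" if s: "0 < s" "r \<le> s" for s
      proof -
        have "test_integral i h (\<gamma> i) \<le> ennreal s * dual_norm i (\<gamma> i)"
          using s r by (intro test_integral_le_dual_norm i h \<gamma>_meas) (auto intro: ennreal_leI)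
        then have "ennreal (K / n i) * test_integral i h (\<gamma> i) \<le> ennreal (K / n i) * (ennreal s * ennreal (n i))"
          using n[OF i] by (intro mult_left_mono) auto
        also have "\<dots> = ennreal (K * s)"
          using K_pos n_pos[OF i] s by (simp add: ennreal_mult[symmetric])
        finally show ?thesis .
      qed
      then show "\<exists>m0. \<forall>m\<ge>m0. ennreal (K / n i) * test_integral i h (\<gamma> i) \<le> ennreal (K * (r + 1 / real (Suc m)))"
        using r(1) by (intro exI[of _ 0] allI impI) (simp add: add_nonneg_pos)
    qed
    also have "\<dots> = ennreal K * Lp_norm (p i) (Y i) h"
      using r K by (simp add: ennreal_mult)
    finally show "(\<integral>\<^sup>+x. ennreal ((if i \<in> I then g i x else 0) * T i h x) \<partial>X)
        \<le> ennreal K * Lp_norm (p i) (Y i) h" using i by simp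
  qed
qed

end

section \<open>The factorisation theorem\<close>

text \<open>
  If \<open>q'\<close> is finite, \<open>\<bar>G\<bar> powr q'\<close> is integrable and its support is that of \<open>G\<close>. If \<open>q = 1\<close>, a
  \<open>\<sigma>\<close>-finite measure has an integrable function that is positive everywhere.
\<close>

lemma exists_integrable_weight:
  assumes q: "1 \<le> q" "1 / q + 1 / q' = 1" and \<sigma>: "q = 1 \<Longrightarrow> sigma_finite_measure X"
    and G: "G \<in> Lp_space q' X"
  obtains w :: "'a \<Rightarrow> ennreal" where "w \<in> borel_measurable X" "(\<integral>\<^sup>+x. w x \<partial>X) < \<infinity>"
    "\<And>x. x \<in> space X \<Longrightarrow> G x \<noteq> 0 \<Longrightarrow> 0 < w x"
proof (cases "q = 1")
  case True
  obtain h where "h \<in> borel_measurable X" "integral\<^sup>N X h \<noteq> \<infinity>" "\<forall>x\<in>space X. 0 < h x \<and> h x < \<infinity>"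
    using sigma_finite_measure.Ex_finite_integrable_function[OF \<sigma>[OF True]] by auto
  then show ?thesis by (intro that[of h]) (auto simp: less_top)
next
  case False
  with q have "q' \<noteq> \<infinity>" by (cases rule: conjugate_exponents_cases) auto
  moreover have [measurable]: "G \<in> borel_measurable X" using G by (simp add: Lp_space_def)
  ultimately show ?thesis
    using G by (intro that[of "\<lambda>x. ennreal (\<bar>G x\<bar> powr enn2real q')"])
      (auto simp: Lp_space_def Lp_norm_def ennreal_power_def less_top split: if_splits)
qed

text \<open>
  For a simple function \<open>f\<close> of arbitrary sign, integrability and the bound follow from those for
  \<open>\<bar>f\<bar>\<close>, as \<open>\<bar>T j f\<bar> \<le> T j \<bar>f\<bar>\<close> almost everywhere and both functions have the same norm.
\<close>

theorem theorem1p3: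
  fixes X :: "'a measure"
    and Y :: "nat \<Rightarrow> 'b measure"
    and T :: "nat \<Rightarrow> ('b \<Rightarrow> real) \<Rightarrow> 'a \<Rightarrow> real"
    and d :: nat
    and p :: "nat \<Rightarrow> ennreal"
    and q q' :: ennreal
    and \<alpha> :: "nat \<Rightarrow> real"
    and A :: real
    and G :: "'a \<Rightarrow> real"
  assumes linear: "\<And>j. j \<in> {1..d} \<Longrightarrow> linear_operator (Y j) X (T j)"
    and positive: "\<And>j. j \<in> {1..d} \<Longrightarrow> positive_operator (Y j) X (T j)"
    and saturating: "\<And>j. j \<in> {1..d} \<Longrightarrow> saturates (Y j) X (T j)"
    and p: "\<And>j. j \<in> {1..d} \<Longrightarrow> 1 \<le> p j"
    and q: "1 \<le> q"
    and conjugate: "1 / q + 1 / q' = 1"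
    and \<alpha>_pos: "\<And>j. j \<in> {1..d} \<Longrightarrow> 0 < \<alpha> j"
    and \<alpha>_sum: "(\<Sum>j=1..d. \<alpha> j) = 1"
    and sigma_finite: "q = 1 \<Longrightarrow> sigma_finite_measure X"
    and A: "0 \<le> A"
    and bound: "\<And>f. (\<And>j. j \<in> {1..d} \<Longrightarrow>
                  f j \<in> simple_functions (Y j) \<and> (\<forall>y\<in>space (Y j). 0 \<le> f j y)) \<Longrightarrow>
        Lp_norm q X (\<lambda>x. \<Prod>j=1..d. T j (f j) x powr \<alpha> j)
          \<le> ennreal A * (\<Prod>j=1..d. ennreal_power (Lp_norm (p j) (Y j) (f j)) (\<alpha> j))"
    and G: "G \<in> Lp_space q' X"
    and G_nonneg: "AE x in X. 0 \<le> G x"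
  shows "\<exists>g :: nat \<Rightarrow> 'a \<Rightarrow> real.
      (\<forall>j\<in>{1..d}. g j \<in> borel_measurable X \<and> (\<forall>x\<in>space X. 0 \<le> g j x)) \<and>
      (AE x in X. G x \<le> (\<Prod>j=1..d. g j x powr \<alpha> j)) \<and>
      (\<forall>j\<in>{1..d}. \<forall>f\<in>simple_functions (Y j).
         integrable X (\<lambda>x. g j x * T j f x) \<and>
         ennreal (\<integral>x. g j x * T j f x \<partial>X)
           \<le> ennreal A * Lp_norm q' X G * Lp_norm (p j) (Y j) f)"
proof -
  let ?K = "A * enn2real (Lp_norm q' X G)"
  have G_measurable [measurable]: "G \<in> borel_measurable X" and G_fin: "Lp_norm q' X G < \<infinity>"
    using G by (auto simp: Lp_space_def)
  then have K_eq: "ennreal ?K = ennreal A * Lp_norm q' X G"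
    using A by (simp add: ennreal_mult)
  obtain w :: "'a \<Rightarrow> ennreal" where w: "w \<in> borel_measurable X" "(\<integral>\<^sup>+x. w x \<partial>X) < \<infinity>"
    "\<And>x. x \<in> space X \<Longrightarrow> G x \<noteq> 0 \<Longrightarrow> 0 < w x"
    using exists_integrable_weight[OF q conjugate sigma_finite G] by blast
  interpret weighted_positive_operators "{1..d}" \<alpha> X Y T p "\<lambda>x. \<bar>G x\<bar>" w ?K
    by unfold_locales (use linear positive p \<alpha>_pos \<alpha>_sum w A in auto)
  have test_bound: "(\<integral>\<^sup>+x. ennreal (\<bar>G x\<bar> * (\<Prod>j=1..d. T j (f j) x powr \<alpha> j)) \<partial>X) \<le> ennreal ?K"
    if f: "f \<in> unit_balls" for f
  proof -
    let ?F = "\<lambda>x. \<Prod>j=1..d. T j (f j) x powr \<alpha> j"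
    note [measurable] = T_unit_ball_measurable[OF f]
    have F_nonneg: "0 \<le> ?F x" for x by (intro prod_nonneg) auto
    have "Lp_norm q X ?F \<le> ennreal A * (\<Prod>j=1..d. ennreal_power (Lp_norm (p j) (Y j) (f j)) (\<alpha> j))"
      using unit_ballD[OF f] by (intro bound) blast
    also have "\<dots> \<le> ennreal A * 1"
      using unit_ballD(3)[OF f] \<alpha>_pos by (intro mult_left_mono prod_le_1) (auto intro: ennreal_power_le_1)
    finally have F: "Lp_norm q X ?F \<le> ennreal A" by simp
    have "(\<integral>\<^sup>+x. ennreal (\<bar>G x\<bar> * ?F x) \<partial>X) = (\<integral>\<^sup>+x. ennreal (\<bar>G x\<bar> * \<bar>?F x\<bar>) \<partial>X)"
      using F_nonneg by simp
    also have "\<dots> \<le> Lp_norm q' X G * Lp_norm q X ?F"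
    proof (rule nn_integral_Holder[OF _ G_measurable q conjugate _ G_fin])
      show "Lp_norm q X ?F < \<infinity>" using F by (auto simp: less_top[symmetric] top_unique)
    qed measurable
    also have "\<dots> \<le> Lp_norm q' X G * ennreal A" using F by (rule mult_left_mono) simp
    finally show ?thesis unfolding K_eq by (simp only: mult.commute)
  qed
  obtain g :: "nat \<Rightarrow> 'a \<Rightarrow> real" where
    g_meas: "\<And>j. j \<in> {1..d} \<Longrightarrow> g j \<in> borel_measurable X" and g_nonneg: "\<And>j x. 0 \<le> g j x"
    and dom: "AE x in X. \<bar>G x\<bar> \<le> (\<Prod>j=1..d. g j x powr \<alpha> j)"
    and g_le: "\<And>j h. j \<in> {1..d} \<Longrightarrow> h \<in> simple_functions (Y j) \<Longrightarrow>
      (\<And>y. y \<in> space (Y j) \<Longrightarrow> 0 \<le> h y) \<Longrightarrow>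
      (\<integral>\<^sup>+x. ennreal (g j x * T j h x) \<partial>X) \<le> ennreal ?K * Lp_norm (p j) (Y j) h"
  proof (rule factorisation)
    show "AE x in X. \<bar>G x\<bar> \<noteq> 0 \<longrightarrow> 0 < w x" using w(3) by auto
  qed (use saturating test_bound in blast)+
  have "integrable X (\<lambda>x. g j x * T j f x) \<and>
      ennreal (\<integral>x. g j x * T j f x \<partial>X) \<le> ennreal A * Lp_norm q' X G * Lp_norm (p j) (Y j) f"
    if j: "j \<in> {1..d}" and f: "f \<in> simple_functions (Y j)" for j f
  proof -
    have [measurable]: "g j \<in> borel_measurable X" "T j f \<in> borel_measurable X"
      using g_meas T_measurable j f by auto
    have abs: "(\<lambda>y. \<bar>f y\<bar>) \<in> simple_functions (Y j)" using f by (rule simple_functions_compose) simp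
    have "AE x in X. ennreal (norm (g j x * T j f x)) \<le> ennreal (g j x * T j (\<lambda>y. \<bar>f y\<bar>) x)"
      using positive_operator_abs_le[OF linear[OF j] positive[OF j] f]
      by eventually_elim (auto simp: abs_mult g_nonneg intro!: ennreal_leI mult_left_mono)
    then have "(\<integral>\<^sup>+x. ennreal (norm (g j x * T j f x)) \<partial>X) \<le> (\<integral>\<^sup>+x. ennreal (g j x * T j (\<lambda>y. \<bar>f y\<bar>) x) \<partial>X)"
      by (rule nn_integral_mono_AE)
    also have "\<dots> \<le> ennreal ?K * Lp_norm (p j) (Y j) (\<lambda>y. \<bar>f y\<bar>)"
      by (rule g_le[OF j abs]) simp
    finally have le: "(\<integral>\<^sup>+x. ennreal (norm (g j x * T j f x)) \<partial>X)
        \<le> ennreal A * Lp_norm q' X G * Lp_norm (p j) (Y j) f"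
      unfolding K_eq Lp_norm_abs .
    also have "\<dots> < \<infinity>"
      using G_fin Lp_norm_simple_function_finite[OF p[OF j] f] by (simp add: ennreal_mult_less_top)
    finally have int: "integrable X (\<lambda>x. g j x * T j f x)" by (intro integrableI_bounded) auto
    have "ennreal (\<integral>x. g j x * T j f x \<partial>X) \<le> ennreal (norm (\<integral>x. g j x * T j f x \<partial>X))"
      by (intro ennreal_leI) simp
    also have "\<dots> \<le> (\<integral>\<^sup>+x. ennreal (norm (g j x * T j f x)) \<partial>X)"
      by (rule integral_norm_bound_ennreal[OF int])
    also note le
    finally show ?thesis using int by blast
  qed
  moreover have "AE x in X. G x \<le> (\<Prod>j=1..d. g j x powr \<alpha> j)"
    using dom by eventually_elim auto
  ultimately show ?thesis using g_meas g_nonneg by (intro exI[of _ g]) blast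
qed

end
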